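(* Let $G$ be a compact group and $n\ge1$. Then $d^{(n+1)}(G)\le\frac{1}{2^n}\big(2^n-1+d(G/Z_n(G))\big)$.
   Context: For a compact group $X$, $\mu_X$ denotes its normalized Haar measure and $\mu_X^m$ the product measure on $X^m$. $Z_n(G)$ is the $n$-th term of the upper central series of $G$ ($Z_0(G)=1$, $Z_{i+1}(G)/Z_i(G)=Z(G/Z_i(G))$); it is closed and normal. Commutators: $[x,y]=x^{-1}y^{-1}xy$, $[x_1,\dots,x_{k+1}]=[[x_1,\dots,x_k],x_{k+1}]$. For a compact group $X$ and $m\ge1$, $d^{(m)}(X)=\mu_X^{m+1}(\{(x_1,\dots,x_{m+1})\in X^{m+1}: [x_1,\dots,x_{m+1}]=1\})$, and $d(X)=d^{(1)}(X)$. *)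

theory Defs
  imports "HOL-Analysis.Analysis" "HOL-Algebra.Algebra"
begin

definition compact_group :: "('a, 'b) monoid_scheme \<Rightarrow> 'a topology \<Rightarrow> bool" where
  "compact_group G T \<longleftrightarrow> group G \<and> topspace T = carrier G \<and> compact_space T \<and> Hausdorff_space T
     \<and> continuous_map (prod_topology T T) T (\<lambda>(x, y). x \<otimes>\<^bsub>G\<^esub> y)
     \<and> continuous_map T T (\<lambda>x. inv\<^bsub>G\<^esub> x)"

definition borel_sets_of :: "'a topology \<Rightarrow> 'a set set" where
  "borel_sets_of T = sigma_sets (topspace T) {U. openin T U}"

definition is_haar :: "('a, 'b) monoid_scheme \<Rightarrow> 'a topology \<Rightarrow> 'a measure \<Rightarrow> bool" where
  "is_haar G T \<mu> \<longleftrightarrow> emeasure \<mu> (space \<mu>) = 1 \<and> space \<mu> = topspace T \<and> sets \<mu> = borel_sets_of T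
     \<and> (\<forall>g\<in>carrier G. \<forall>A\<in>sets \<mu>. emeasure \<mu> ((\<lambda>x. g \<otimes>\<^bsub>G\<^esub> x) ` A) = emeasure \<mu> A)
     \<and> (\<forall>A\<in>sets \<mu>. emeasure \<mu> A = (INF U\<in>{U. openin T U \<and> A \<subseteq> U}. emeasure \<mu> U))
     \<and> (\<forall>U. openin T U \<longrightarrow> emeasure \<mu> U = (SUP K\<in>{K. compactin T K \<and> K \<subseteq> U}. emeasure \<mu> K))"

definition haar_measure :: "('a, 'b) monoid_scheme \<Rightarrow> 'a topology \<Rightarrow> 'a measure" where
  "haar_measure G T = (THE \<mu>. is_haar G T \<mu>)"

definition commutator :: "('a, 'b) monoid_scheme \<Rightarrow> 'a \<Rightarrow> 'a \<Rightarrow> 'a" where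
  "commutator G x y = inv\<^bsub>G\<^esub> x \<otimes>\<^bsub>G\<^esub> inv\<^bsub>G\<^esub> y \<otimes>\<^bsub>G\<^esub> x \<otimes>\<^bsub>G\<^esub> y"

fun iter_comm :: "('a, 'b) monoid_scheme \<Rightarrow> (nat \<Rightarrow> 'a) \<Rightarrow> nat \<Rightarrow> 'a" where
  "iter_comm G x 0 = x 0"
| "iter_comm G x (Suc k) = commutator G (iter_comm G x k) (x (Suc k))"

definition group_center :: "('a, 'b) monoid_scheme \<Rightarrow> 'a set" where
  "group_center G = {x \<in> carrier G. \<forall>y\<in>carrier G. x \<otimes>\<^bsub>G\<^esub> y = y \<otimes>\<^bsub>G\<^esub> x}"

fun upper_central :: "('a, 'b) monoid_scheme \<Rightarrow> nat \<Rightarrow> 'a set" where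
  "upper_central G 0 = {\<one>\<^bsub>G\<^esub>}"
| "upper_central G (Suc i) =
     {x \<in> carrier G. upper_central G i #>\<^bsub>G\<^esub> x \<in> group_center (G Mod upper_central G i)}"

definition quotient_top :: "('a, 'b) monoid_scheme \<Rightarrow> 'a topology \<Rightarrow> 'a set \<Rightarrow> 'a set topology" where
  "quotient_top G T N = topology (\<lambda>U. U \<subseteq> rcosets\<^bsub>G\<^esub> N \<and> openin T (\<Union>U))"

definition comm_degree :: "nat \<Rightarrow> ('a, 'b) monoid_scheme \<Rightarrow> 'a topology \<Rightarrow> real" where
  "comm_degree m G T =
     measure (haar_measure (product_group {..m} (\<lambda>_. G)) (product_topology (\<lambda>_. T) {..m}))
       {x \<in> (\<Pi>\<^sub>E i\<in>{..m}. carrier G). iter_comm G x m = \<one>\<^bsub>G\<^esub>}"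

end

theory Submission
  imports Defs
begin

text \<open>
  Put \<open>E\<^sub>k = {x. [x\<^sub>0, \<dots>, x\<^sub>k] \<in> Z\<^sub>n\<^sub>+\<^sub>1\<^sub>-\<^sub>k}\<close>. If \<open>a = [x\<^sub>0, \<dots>, x\<^sub>k]\<close> is not in \<open>Z\<^sub>j\<^sub>+\<^sub>1\<close>, then the
  elements \<open>y\<close> with \<open>[a, y] \<in> Z\<^sub>j\<close> form a proper subgroup, so each step from \<open>k\<close> to \<open>k + 1\<close> at most
  halves the measure of the complement of \<open>E\<^sub>k\<close>; moreover \<open>E\<^sub>1\<close> has measure \<open>d(G/Z\<^sub>n)\<close> because Haar
  measure is pushed forward to Haar measure.

  The Borel sets of a power of \<open>G\<close> need not be generated by boxes, so Fubini is not available. Instead,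
  the complement of \<open>E\<^sub>k\<close> is covered by open sets on which a single \<open>g\<close> with \<open>[a, g] \<notin> Z\<^sub>j\<close> works;
  translating coordinate \<open>k + 1\<close> by \<open>g\<close> there moves the bad set off itself, and inner regularity
  reduces to finitely many of these sets.

  Existence and uniqueness of Haar measure both come from one counting fact: if \<open>A\<close> is a finite set of
  least cardinality with \<open>A V = G\<close>, then \<open>|gA \<inter> K| \<le> |hA \<inter> U|\<close> for all \<open>g\<close>, \<open>h\<close> whenever
  \<open>K V V\<inverse> \<subseteq> U\<close>. By compactness, the normalized counting measures of such sets \<open>A\<close> accumulate at a finitely
  additive probability that is invariant up to passing from closed sets to open neighbourhoods.
\<close>

section \<open>Regular Borel measures\<close>

definition borel_of :: "'a topology \<Rightarrow> 'a measure" where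
  "borel_of T = sigma (topspace T) {U. openin T U}"

lemma space_borel_of [simp]: "space (borel_of T) = topspace T"
  unfolding borel_of_def by (rule space_measure_of) (auto dest: openin_subset)

lemma sets_borel_of: "sets (borel_of T) = borel_sets_of T"
  unfolding borel_of_def borel_sets_of_def by (rule sets_measure_of) (auto dest: openin_subset)

lemma openin_in_sets_borel_of: "openin T U \<Longrightarrow> U \<in> sets (borel_of T)"
  by (simp add: sets_borel_of borel_sets_of_def sigma_sets.Basic)

lemma closedin_in_sets_borel_of:
  assumes "closedin T K"
  shows "K \<in> sets (borel_of T)"
proof -
  have "space (borel_of T) - (topspace T - K) \<in> sets (borel_of T)"
    using assms by (intro sets.compl_sets openin_in_sets_borel_of) auto
  then show ?thesis using closedin_subset[OF assms] by (simp add: double_diff)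
qed

lemma measurable_borel_of_continuous_map:
  assumes "continuous_map S T f"
  shows "f \<in> borel_of S \<rightarrow>\<^sub>M borel_of T"
  unfolding borel_of_def[of T]
proof (rule measurable_measure_of)
  show "f \<in> space (borel_of S) \<rightarrow> topspace T" using assms by (simp add: continuous_map_funspace)
  show "f -` U \<inter> space (borel_of S) \<in> sets (borel_of S)" if "U \<in> {U. openin T U}" for U
  proof -
    have "f -` U \<inter> space (borel_of S) = {x \<in> topspace S. f x \<in> U}" by auto
    then show ?thesis
      using openin_continuous_map_preimage[OF assms] that by (simp add: openin_in_sets_borel_of)
  qed
qed (auto dest: openin_subset)

lemma vimage_in_sets_borel_of:
  assumes "continuous_map S T f" and "A \<in> sets (borel_of T)"
  shows "f -` A \<inter> topspace S \<in> sets (borel_of S)"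
  using measurable_sets[OF measurable_borel_of_continuous_map[OF assms(1)] assms(2)] by simp

definition regular_borel_measure :: "'a topology \<Rightarrow> 'a measure \<Rightarrow> bool" where
  "regular_borel_measure T \<mu> \<longleftrightarrow> sets \<mu> = sets (borel_of T)
     \<and> (\<forall>A\<in>sets \<mu>. emeasure \<mu> A = (INF U\<in>{U. openin T U \<and> A \<subseteq> U}. emeasure \<mu> U))
     \<and> (\<forall>U. openin T U \<longrightarrow> emeasure \<mu> U = (SUP K\<in>{K. compactin T K \<and> K \<subseteq> U}. emeasure \<mu> K))"

lemma regular_borel_measureI:
  assumes sets: "sets \<mu> = sets (borel_of T)"
    and outer: "\<And>A. A \<in> sets \<mu> \<Longrightarrow> (INF U\<in>{U. openin T U \<and> A \<subseteq> U}. emeasure \<mu> U) \<le> emeasure \<mu> A"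
    and inner: "\<And>U. openin T U \<Longrightarrow> emeasure \<mu> U \<le> (SUP K\<in>{K. compactin T K \<and> K \<subseteq> U}. emeasure \<mu> K)"
  shows "regular_borel_measure T \<mu>"
  unfolding regular_borel_measure_def
  by (intro conjI ballI allI impI antisym sets outer inner SUP_least INF_greatest emeasure_mono)
    (auto simp: sets openin_in_sets_borel_of)

context
  fixes T :: "'a topology" and \<mu> :: "'a measure"
  assumes \<mu>: "regular_borel_measure T \<mu>"
begin

lemma regular_borel_measure_sets: "sets \<mu> = sets (borel_of T)"
  using \<mu> by (simp add: regular_borel_measure_def)

lemma regular_borel_measure_space: "space \<mu> = topspace T"
  using sets_eq_imp_space_eq[OF regular_borel_measure_sets] by simp

lemma regular_borel_measure_outer:
  "A \<in> sets (borel_of T) \<Longrightarrow> emeasure \<mu> A = (INF U\<in>{U. openin T U \<and> A \<subseteq> U}. emeasure \<mu> U)"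
  using \<mu> unfolding regular_borel_measure_def by blast

lemma regular_borel_measure_inner:
  "openin T U \<Longrightarrow> emeasure \<mu> U = (SUP K\<in>{K. compactin T K \<and> K \<subseteq> U}. emeasure \<mu> K)"
  using \<mu> unfolding regular_borel_measure_def by blast

lemma regular_borel_measure_Union_le:
  assumes U: "\<And>j. j \<in> J \<Longrightarrow> openin T (U j)"
    and finite_le: "\<And>D. finite D \<Longrightarrow> D \<subseteq> J \<Longrightarrow> emeasure \<mu> (\<Union>j\<in>D. U j) \<le> c"
  shows "emeasure \<mu> (\<Union>j\<in>J. U j) \<le> c"
proof -
  have open_Union: "openin T (\<Union>j\<in>D. U j)" if "D \<subseteq> J" for D
    using U that by (intro openin_Union) auto
  have "emeasure \<mu> K \<le> c" if K: "compactin T K" "K \<subseteq> (\<Union>j\<in>J. U j)" for K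
  proof -
    have "\<forall>V\<in>U ` J. openin T V" using U by blast
    then obtain \<F> where "finite \<F>" "\<F> \<subseteq> U ` J" "K \<subseteq> \<Union>\<F>"
      using K unfolding compactin_def by meson
    then obtain D where D: "finite D" "D \<subseteq> J" "K \<subseteq> (\<Union>j\<in>D. U j)"
      using finite_subset_image[of \<F> U J] by auto
    have "emeasure \<mu> K \<le> emeasure \<mu> (\<Union>j\<in>D. U j)"
      using D open_Union[OF D(2)]
      by (intro emeasure_mono) (auto simp: regular_borel_measure_sets openin_in_sets_borel_of)
    then show ?thesis using finite_le[OF D(1,2)] by simp
  qed
  then show ?thesis
    unfolding regular_borel_measure_inner[OF open_Union[OF subset_refl]] by (auto intro: SUP_least)
qed

lemma measurable_regular_borel_measure:
  "continuous_map T S f \<Longrightarrow> f \<in> \<mu> \<rightarrow>\<^sub>M borel_of S"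
  by (simp add: measurable_borel_of_continuous_map
      measurable_cong_sets[OF regular_borel_measure_sets refl])

lemma emeasure_distr_regular_borel_measure:
  assumes "continuous_map T S f" "A \<in> sets (borel_of S)"
  shows "emeasure (distr \<mu> (borel_of S) f) A = emeasure \<mu> (f -` A \<inter> topspace T)"
  using emeasure_distr[OF measurable_regular_borel_measure[OF assms(1)] assms(2)]
  by (simp add: regular_borel_measure_space)

lemma INF_openin_distr_le:
  assumes cont: "continuous_map T S f" and closed: "closed_map T S f" and A: "A \<in> sets (borel_of S)"
  defines "\<nu> \<equiv> distr \<mu> (borel_of S) f"
  shows "(INF U\<in>{U. openin S U \<and> A \<subseteq> U}. emeasure \<nu> U) \<le> emeasure \<nu> A"
proof -
  note emeasure_\<nu> = emeasure_distr_regular_borel_measure[OF cont, folded \<nu>_def]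
  show ?thesis
    unfolding emeasure_\<nu>[OF A] regular_borel_measure_outer[OF vimage_in_sets_borel_of[OF cont A]]
  proof (rule INF_mono, clarify)
    fix W assume W: "openin T W" "f -` A \<inter> topspace T \<subseteq> W"
    \<comment> \<open>the largest set whose preimage lies in \<open>W\<close>; it is open because \<open>f\<close> is closed\<close>
    let ?U = "topspace S - f ` (topspace T - W)"
    have U: "openin S ?U"
      using closed W(1) by (intro openin_diff openin_topspace) (auto simp: closed_map_def)
    have "A \<subseteq> ?U" using sets.sets_into_space[OF A] W by auto
    moreover have "emeasure \<nu> ?U \<le> emeasure \<mu> W"
      unfolding emeasure_\<nu>[OF openin_in_sets_borel_of[OF U]] using W(1)
      by (intro emeasure_mono) (auto simp: regular_borel_measure_sets openin_in_sets_borel_of)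
    ultimately show "\<exists>U\<in>{U. openin S U \<and> A \<subseteq> U}. emeasure \<nu> U \<le> emeasure \<mu> W"
      using U by blast
  qed
qed

lemma distr_le_SUP_compactin:
  assumes cont: "continuous_map T S f" and Haus: "Hausdorff_space S" and U: "openin S U"
  defines "\<nu> \<equiv> distr \<mu> (borel_of S) f"
  shows "emeasure \<nu> U \<le> (SUP K\<in>{K. compactin S K \<and> K \<subseteq> U}. emeasure \<nu> K)"
proof -
  note emeasure_\<nu> = emeasure_distr_regular_borel_measure[OF cont, folded \<nu>_def]
  have "f -` U \<inter> topspace T = {x \<in> topspace T. f x \<in> U}" by auto
  then have open_vimage: "openin T (f -` U \<inter> topspace T)"
    using openin_continuous_map_preimage[OF cont U] by simp
  show ?thesis
    unfolding emeasure_\<nu>[OF openin_in_sets_borel_of[OF U]] regular_borel_measure_inner[OF open_vimage]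
  proof (rule SUP_mono, clarify)
    fix K assume K: "compactin T K" "K \<subseteq> f -` U \<inter> topspace T"
    have image: "compactin S (f ` K)" by (rule image_compactin[OF K(1) cont])
    then have "f ` K \<in> sets (borel_of S)"
      by (intro closedin_in_sets_borel_of compactin_imp_closedin[OF Haus])
    then have "emeasure \<mu> K \<le> emeasure \<nu> (f ` K)"
      using K(2) vimage_in_sets_borel_of[OF cont]
      by (subst emeasure_\<nu>) (auto intro!: emeasure_mono simp: regular_borel_measure_sets)
    then show "\<exists>L\<in>{K. compactin S K \<and> K \<subseteq> U}. emeasure \<mu> K \<le> emeasure \<nu> L"
      using K image by (intro bexI[of _ "f ` K"]) auto
  qed
qed

lemma regular_borel_measure_distr:
  assumes "continuous_map T S f" and "closed_map T S f" and "Hausdorff_space S"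
  shows "regular_borel_measure S (distr \<mu> (borel_of S) f)"
  using assms by (intro regular_borel_measureI INF_openin_distr_le distr_le_SUP_compactin) simp_all

end

lemma regular_borel_measure_eqI:
  assumes \<mu>: "regular_borel_measure T \<mu>" and \<nu>: "regular_borel_measure T \<nu>"
    and compact: "\<And>K. compactin T K \<Longrightarrow> emeasure \<mu> K = emeasure \<nu> K"
  shows "\<mu> = \<nu>"
proof (rule measure_eqI)
  show "sets \<mu> = sets \<nu>"
    by (simp add: regular_borel_measure_sets[OF \<mu>] regular_borel_measure_sets[OF \<nu>])
  fix A assume "A \<in> sets \<mu>"
  then have A: "A \<in> sets (borel_of T)" by (simp add: regular_borel_measure_sets[OF \<mu>])
  have "emeasure \<mu> U = emeasure \<nu> U" if U: "openin T U" for U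
    unfolding regular_borel_measure_inner[OF \<mu> U] regular_borel_measure_inner[OF \<nu> U]
    by (intro SUP_cong refl compact) auto
  then show "emeasure \<mu> A = emeasure \<nu> A"
    unfolding regular_borel_measure_outer[OF \<mu> A] regular_borel_measure_outer[OF \<nu> A]
    by (intro INF_cong) auto
qed

section \<open>Contents on compact Hausdorff spaces\<close>

locale compact_Hausdorff_topology =
  fixes T :: "'a topology"
  assumes compact_space: "compact_space T" and Hausdorff_space: "Hausdorff_space T"
begin

lemma compactin_iff_closedin: "compactin T K \<longleftrightarrow> closedin T K"
  using compact_space Hausdorff_space closedin_compact_space compactin_imp_closedin by blast

lemma normal_space: "normal_space T"
  using compact_space Hausdorff_space compact_Hausdorff_or_regular_imp_normal_space by blast

end

locale topological_content = compact_Hausdorff_topology T for T :: "'a topology" +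
  fixes l :: "'a set \<Rightarrow> ennreal"
  assumes content_empty: "l {} = 0"
    and content_mono: "\<And>K L. closedin T K \<Longrightarrow> closedin T L \<Longrightarrow> K \<subseteq> L \<Longrightarrow> l K \<le> l L"
    and content_subadditive: "\<And>K L. closedin T K \<Longrightarrow> closedin T L \<Longrightarrow> l (K \<union> L) \<le> l K + l L"
    and content_additive:
      "\<And>K L. closedin T K \<Longrightarrow> closedin T L \<Longrightarrow> K \<inter> L = {} \<Longrightarrow> l (K \<union> L) = l K + l L"
begin

definition open_content :: "'a set \<Rightarrow> ennreal" where
  "open_content U = (SUP K\<in>{K. closedin T K \<and> K \<subseteq> U}. l K)"

definition outer_content :: "'a set \<Rightarrow> ennreal" where
  "outer_content A = (INF U\<in>{U. openin T U \<and> A \<subseteq> U}. open_content U)"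

lemma content_le_open_content: "closedin T K \<Longrightarrow> K \<subseteq> U \<Longrightarrow> l K \<le> open_content U"
  unfolding open_content_def by (auto intro: SUP_upper)

lemma open_content_le_content: "closedin T L \<Longrightarrow> U \<subseteq> L \<Longrightarrow> open_content U \<le> l L"
  unfolding open_content_def by (intro SUP_least) (auto intro: content_mono)

lemma open_content_empty: "open_content {} = 0"
  using open_content_le_content[of "{}" "{}"] by (simp add: content_empty)

lemma open_content_mono: "U \<subseteq> V \<Longrightarrow> open_content U \<le> open_content V"
  unfolding open_content_def by (intro SUP_subset_mono) auto

lemma outer_content_le_open_content:
  "openin T U \<Longrightarrow> A \<subseteq> U \<Longrightarrow> outer_content A \<le> open_content U"
  unfolding outer_content_def by (auto intro: INF_lower)

lemma outer_content_open: "openin T U \<Longrightarrow> outer_content U = open_content U"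
  unfolding outer_content_def
  by (intro antisym INF_lower INF_greatest) (auto intro: open_content_mono)

lemma outer_content_mono: "A \<subseteq> B \<Longrightarrow> outer_content A \<le> outer_content B"
  unfolding outer_content_def by (intro INF_superset_mono) auto

lemma content_le_outer_content: "closedin T K \<Longrightarrow> l K \<le> outer_content K"
  unfolding outer_content_def by (intro INF_greatest) (auto intro: content_le_open_content)

lemma open_content_Un:
  assumes U: "openin T U" and V: "openin T V"
  shows "open_content (U \<union> V) \<le> open_content U + open_content V"
  unfolding open_content_def[of "U \<union> V"]
proof (rule SUP_least, clarify)
  fix K assume K: "closedin T K" "K \<subseteq> U \<union> V"
  have "closedin T (K - U)" "closedin T (K - V)" "disjnt (K - U) (K - V)"
    using K U V by (auto simp: disjnt_def)
  then obtain A B where AB: "openin T A" "openin T B" "K - U \<subseteq> A" "K - V \<subseteq> B" "disjnt A B"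
    using normal_space unfolding normal_space_def by metis
  have "K = (K - A) \<union> (K - B)" using AB(5) by (auto simp: disjnt_def)
  then have "l K \<le> l (K - A) + l (K - B)"
    using content_subadditive[of "K - A" "K - B"] AB K(1) by auto
  also have "\<dots> \<le> open_content U + open_content V"
    using AB K by (intro add_mono content_le_open_content) auto
  finally show "l K \<le> open_content U + open_content V" .
qed

lemma open_content_UN_lessThan:
  fixes U :: "nat \<Rightarrow> 'a set"
  assumes "\<And>i. openin T (U i)"
  shows "open_content (\<Union>i<n. U i) \<le> (\<Sum>i<n. open_content (U i))"
proof (induction n)
  case 0 then show ?case by (simp add: open_content_empty)
next
  case (Suc n)
  have "open_content (\<Union>i<Suc n. U i) \<le> open_content (\<Union>i<n. U i) + open_content (U n)"
    using assms by (subst lessThan_Suc, subst UN_insert, subst Un_commute) (intro open_content_Un, auto)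
  also have "\<dots> \<le> (\<Sum>i<n. open_content (U i)) + open_content (U n)"
    by (intro add_right_mono Suc.IH)
  finally show ?case by simp
qed

lemma open_content_UN:
  fixes U :: "nat \<Rightarrow> 'a set"
  assumes U: "\<And>i. openin T (U i)"
  shows "open_content (\<Union>i. U i) \<le> suminf (\<lambda>i. open_content (U i))"
  unfolding open_content_def[of "\<Union>i. U i"]
proof (rule SUP_least, clarify)
  fix K assume K: "closedin T K" "K \<subseteq> (\<Union>i. U i)"
  then have "compactin T K" by (simp add: compactin_iff_closedin)
  then obtain \<F> where \<F>: "finite \<F>" "\<F> \<subseteq> range U" "K \<subseteq> \<Union>\<F>"
    using K U unfolding compactin_def by (metis (no_types, lifting) image_iff)
  then obtain I where I: "finite I" "\<F> = U ` I" by (meson finite_subset_image)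
  obtain n where n: "I \<subseteq> {..<n}" using I(1) finite_nat_iff_bounded by blast
  have "l K \<le> open_content (\<Union>i<n. U i)"
    using K \<F> I n by (intro content_le_open_content) blast+
  also have "\<dots> \<le> (\<Sum>i<n. open_content (U i))" by (rule open_content_UN_lessThan[OF U])
  also have "\<dots> \<le> suminf (\<lambda>i. open_content (U i))" by (intro sum_le_suminf) auto
  finally show "l K \<le> suminf (\<lambda>i. open_content (U i))" .
qed

lemma outer_content_UN:
  fixes A :: "nat \<Rightarrow> 'a set"
  shows "outer_content (\<Union>i. A i) \<le> suminf (\<lambda>i. outer_content (A i))"
proof (rule ennreal_le_epsilon)
  fix e :: real assume e: "0 < e" and "suminf (\<lambda>i. outer_content (A i)) < top_class.top"
  then have less: "outer_content (A i) < outer_content (A i) + ennreal (e * (1/2)^Suc i)" for i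
    by (auto simp: less_top dest!: ennreal_suminf_lessD)
  have "\<exists>U. openin T U \<and> A i \<subseteq> U \<and> open_content U \<le> outer_content (A i) + ennreal (e * (1/2)^Suc i)" for i
    using less[of i] unfolding outer_content_def[of "A i"] INF_less_iff by (auto intro: less_imp_le)
  then obtain U where U: "\<And>i. openin T (U i)" "\<And>i. A i \<subseteq> U i"
    and U_le: "\<And>i. open_content (U i) \<le> outer_content (A i) + ennreal (e * (1/2)^Suc i)"
    by metis
  have "outer_content (\<Union>i. A i) \<le> open_content (\<Union>i. U i)"
    using U by (intro outer_content_le_open_content) auto
  also have "\<dots> \<le> suminf (\<lambda>i. open_content (U i))" by (rule open_content_UN[OF U(1)])
  also have "\<dots> \<le> suminf (\<lambda>i. outer_content (A i) + ennreal (e * (1/2)^Suc i))"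
    by (intro suminf_le U_le) auto
  also have "\<dots> = suminf (\<lambda>i. outer_content (A i)) + suminf (\<lambda>i. ennreal (e * (1/2)^Suc i))"
    by (intro suminf_add[symmetric]) auto
  also have "suminf (\<lambda>i. ennreal (e * (1/2)^Suc i)) = ennreal e"
    using e sums_mult[OF power_half_series, of e] by (intro suminf_ennreal_eq) auto
  finally show "outer_content (\<Union>i. A i) \<le> suminf (\<lambda>i. outer_content (A i)) + ennreal e" .
qed

lemma content_add_outer_content_Diff_le:
  assumes W: "openin T W" and K: "closedin T K" "K \<subseteq> W" and A: "A \<subseteq> W - K"
  shows "l K + outer_content A \<le> open_content W"
proof -
  have nonempty: "{L. closedin T L \<and> L \<subseteq> W - K} \<noteq> {}" by (auto intro: exI[of _ "{}"])
  have "l K + outer_content A \<le> l K + open_content (W - K)"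
    using W K A by (intro add_left_mono outer_content_le_open_content) auto
  also have "\<dots> = (SUP L\<in>{L. closedin T L \<and> L \<subseteq> W - K}. l K + l L)"
    unfolding open_content_def by (rule ennreal_SUP_add_right[OF nonempty])
  also have "\<dots> \<le> open_content W"
  proof (rule SUP_least, clarify)
    fix L assume L: "closedin T L" "L \<subseteq> W - K"
    have "l K + l L = l (K \<union> L)" using K L by (intro content_additive[symmetric]) auto
    also have "\<dots> \<le> open_content W" using K L by (intro content_le_open_content) auto
    finally show "l K + l L \<le> open_content W" .
  qed
  finally show ?thesis .
qed

lemma outer_content_Int_add_Diff_le:
  assumes U: "openin T U"
  shows "outer_content (A \<inter> U) + outer_content (A - U) \<le> outer_content A"
  unfolding outer_content_def[of A]
proof (rule INF_greatest, clarify)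
  fix W assume W: "openin T W" "A \<subseteq> W"
  have nonempty: "{K. closedin T K \<and> K \<subseteq> W \<inter> U} \<noteq> {}" by (auto intro: exI[of _ "{}"])
  have "outer_content (A \<inter> U) + outer_content (A - U) \<le> open_content (W \<inter> U) + outer_content (A - U)"
    using U W by (intro add_right_mono outer_content_le_open_content) auto
  also have "\<dots> = (SUP K\<in>{K. closedin T K \<and> K \<subseteq> W \<inter> U}. l K + outer_content (A - U))"
    unfolding open_content_def by (rule ennreal_SUP_add_left[symmetric, OF nonempty])
  also have "\<dots> \<le> open_content W"
    using W by (intro SUP_least content_add_outer_content_Diff_le) auto
  finally show "outer_content (A \<inter> U) + outer_content (A - U) \<le> open_content W" .
qed

lemma outer_measure_space_outer_content: "outer_measure_space (Pow (topspace T)) outer_content"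
  unfolding outer_measure_space_def positive_def increasing_def countably_subadditive_def
  by (simp add: outer_content_open open_content_empty outer_content_mono outer_content_UN)

lemma openin_in_lambda_system_outer_content:
  assumes U: "openin T U"
  shows "U \<in> lambda_system (topspace T) (Pow (topspace T)) outer_content"
proof -
  interpret sigma_algebra "topspace T" "Pow (topspace T)" by (rule sigma_algebra_Pow)
  have U': "U \<in> Pow (topspace T)" using U openin_subset by auto
  have "outer_content (A \<inter> U) + outer_content (A - U) = outer_content A" if A: "A \<in> Pow (topspace T)" for A
  proof (rule antisym[OF outer_content_Int_add_Diff_le[OF U]])
    have "outer_content ((A \<inter> U) \<union> (A - U)) \<le> outer_content (A \<inter> U) + outer_content (A - U)"
      using outer_measure_space_outer_content A U' unfolding outer_measure_space_def
      by (intro subadditiveD[OF countably_subadditive_subadditive]) auto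
    then show "outer_content A \<le> outer_content (A \<inter> U) + outer_content (A - U)"
      by (simp add: Int_Diff_Un)
  qed
  then show ?thesis using U' by (simp add: lambda_system_eq)
qed

lemma measure_space_outer_content:
  "measure_space (topspace T) (sets (borel_of T)) outer_content"
proof -
  let ?\<Lambda> = "lambda_system (topspace T) (Pow (topspace T)) outer_content"
  have \<Lambda>: "measure_space (topspace T) ?\<Lambda> outer_content"
    by (intro sigma_algebra.caratheodory_lemma sigma_algebra_Pow outer_measure_space_outer_content)
  then have "sigma_algebra (topspace T) ?\<Lambda>" by (simp add: measure_space_def)
  then have "sets (borel_of T) \<subseteq> ?\<Lambda>"
    unfolding sets_borel_of borel_sets_of_def
    by (rule sigma_algebra.sigma_sets_subset) (auto intro: openin_in_lambda_system_outer_content)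
  moreover have "sigma_algebra (topspace T) (sets (borel_of T))"
    using sets.sigma_algebra_axioms[of "borel_of T"] by simp
  ultimately show ?thesis using \<Lambda> measure_down by blast
qed

definition content_measure :: "'a measure" where
  "content_measure = measure_of (topspace T) (sets (borel_of T)) outer_content"

lemma sets_content_measure: "sets content_measure = sets (borel_of T)"
  using sets.sets_measure_of_eq[of "borel_of T"] by (simp add: content_measure_def)

lemma emeasure_content_measure:
  "A \<in> sets (borel_of T) \<Longrightarrow> emeasure content_measure A = outer_content A"
  using measure_space_outer_content unfolding content_measure_def measure_space_def
  by (intro emeasure_measure_of_sigma) auto

lemma emeasure_content_measure_topspace: "emeasure content_measure (topspace T) = l (topspace T)"
proof -
  have "emeasure content_measure (topspace T) = open_content (topspace T)"
    by (simp add: emeasure_content_measure openin_in_sets_borel_of outer_content_open)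
  also have "\<dots> = l (topspace T)"
    by (intro antisym open_content_le_content content_le_open_content) auto
  finally show ?thesis .
qed

lemma regular_borel_measure_content_measure: "regular_borel_measure T content_measure"
proof (rule regular_borel_measureI[OF sets_content_measure])
  have open_eq: "emeasure content_measure U = open_content U" if "openin T U" for U
    using that by (simp add: emeasure_content_measure openin_in_sets_borel_of outer_content_open)
  show "(INF U\<in>{U. openin T U \<and> A \<subseteq> U}. emeasure content_measure U) \<le> emeasure content_measure A"
    if "A \<in> sets content_measure" for A
  proof -
    have "(INF U\<in>{U. openin T U \<and> A \<subseteq> U}. emeasure content_measure U) = outer_content A"
      unfolding outer_content_def by (intro INF_cong refl open_eq) auto
    then show ?thesis using that by (simp add: sets_content_measure emeasure_content_measure)
  qed
  show "emeasure content_measure U \<le> (SUP K\<in>{K. compactin T K \<and> K \<subseteq> U}. emeasure content_measure K)"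
    if U: "openin T U" for U
    unfolding open_eq[OF U] open_content_def
    by (intro SUP_mono)
      (auto simp: compactin_iff_closedin emeasure_content_measure closedin_in_sets_borel_of
        intro: content_le_outer_content)
qed

lemma open_content_homeomorphic_image_le:
  assumes f: "homeomorphic_map T T f"
    and image_le: "\<And>K U L. closedin T K \<Longrightarrow> openin T U \<Longrightarrow> closedin T L \<Longrightarrow> K \<subseteq> U \<Longrightarrow> U \<subseteq> L \<Longrightarrow> l (f ` K) \<le> l L"
    and U: "openin T U"
  shows "open_content (f ` U) \<le> open_content U"
  unfolding open_content_def[of "f ` U"]
proof (rule SUP_least, clarify)
  fix K assume K: "closedin T K" "K \<subseteq> f ` U"
  let ?K = "{x \<in> topspace T. f x \<in> K}"
  have inj: "inj_on f (topspace T)"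
    using f by (simp add: homeomorphic_eq_everything_map)
  have UT: "U \<subseteq> topspace T" by (rule openin_subset[OF U])
  have K': "closedin T ?K"
    by (rule closedin_continuous_map_preimage[OF homeomorphic_imp_continuous_map[OF f] K(1)])
  have KU: "?K \<subseteq> U" using K(2) inj UT by (auto simp: inj_on_def)
  obtain W where W: "openin T W" "?K \<subseteq> W" "T closure_of W \<subseteq> U"
    using normal_space[unfolded normal_space_alt, rule_format, OF conjI[OF K' conjI[OF U KU]]]
    by (elim exE conjE) (rule that)
  have "f ` ?K = K" using K(2) UT by auto
  then have "l K \<le> l (T closure_of W)"
    using image_le[OF K' W(1) closedin_closure_of W(2)] closure_of_subset[OF openin_subset[OF W(1)]] by simp
  also have "\<dots> \<le> open_content U" using W(3) by (intro content_le_open_content) auto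
  finally show "l K \<le> open_content U" .
qed

lemma outer_content_homeomorphic_image_le:
  assumes f: "homeomorphic_map T T f"
    and image_le: "\<And>K U L. closedin T K \<Longrightarrow> openin T U \<Longrightarrow> closedin T L \<Longrightarrow> K \<subseteq> U \<Longrightarrow> U \<subseteq> L \<Longrightarrow> l (f ` K) \<le> l L"
  shows "outer_content (f ` A) \<le> outer_content A"
  unfolding outer_content_def[of A]
proof (rule INF_greatest, clarify)
  fix U assume U: "openin T U" "A \<subseteq> U"
  have "openin T (f ` U)"
    using f U(1) by (auto simp: homeomorphic_map_openness openin_subset)
  then have "outer_content (f ` A) \<le> open_content (f ` U)"
    using U(2) by (intro outer_content_le_open_content) auto
  also have "\<dots> \<le> open_content U" by (rule open_content_homeomorphic_image_le[OF f image_le U(1)])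
  finally show "outer_content (f ` A) \<le> open_content U" .
qed

end

definition finitely_additive_probability :: "'a set \<Rightarrow> ('a set \<Rightarrow> real) \<Rightarrow> bool" where
  "finitely_additive_probability \<Omega> l \<longleftrightarrow>
     (\<forall>A. l A \<in> {0..1}) \<and> l \<Omega> = 1 \<and> (\<forall>A B. A \<inter> B = {} \<longrightarrow> l (A \<union> B) = l A + l B)"

lemma finitely_additive_probability_mono:
  assumes l: "finitely_additive_probability \<Omega> l" and "A \<subseteq> B"
  shows "l A \<le> l B"
proof -
  have "l (A \<union> (B - A)) = l A + l (B - A)"
    using l unfolding finitely_additive_probability_def by blast
  moreover have "0 \<le> l (B - A)"
    using l by (simp add: finitely_additive_probability_def)
  ultimately show ?thesis using assms(2) by (simp add: Un_absorb1)
qed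

lemma compact_finitely_additive_probability:
  "compact {l :: 'a set \<Rightarrow> real. finitely_additive_probability \<Omega> l}"
proof -
  have coord: "continuous_on UNIV (\<lambda>l :: 'a set \<Rightarrow> real. l A)" for A
    by (rule continuous_on_product_coordinates)
  have "closed {l :: 'a set \<Rightarrow> real. A \<inter> B = {} \<longrightarrow> l (A \<union> B) = l A + l B}" for A B
    by (cases "A \<inter> B = {}") (auto intro!: closed_Collect_eq continuous_on_add coord)
  then have "closed {l :: 'a set \<Rightarrow> real. l \<Omega> = 1 \<and> (\<forall>A B. A \<inter> B = {} \<longrightarrow> l (A \<union> B) = l A + l B)}"
    by (intro closed_Collect_conj closed_Collect_all closed_Collect_eq coord continuous_on_const)
  moreover have "compactin (product_topology (\<lambda>_. euclideanreal) UNIV) (PiE UNIV (\<lambda>_ :: 'a set. {0..1}))"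
    by (subst compactin_PiE) simp
  then have "compact (PiE UNIV (\<lambda>_ :: 'a set. {0..1 :: real}))"
    by (simp add: euclidean_product_topology)
  ultimately have "compact (PiE UNIV (\<lambda>_. {0..1}) \<inter>
      {l :: 'a set \<Rightarrow> real. l \<Omega> = 1 \<and> (\<forall>A B. A \<inter> B = {} \<longrightarrow> l (A \<union> B) = l A + l B)})"
    by (rule compact_Int_closed[rotated])
  also have "\<dots> = {l. finitely_additive_probability \<Omega> l}"
    by (auto simp: finitely_additive_probability_def)
  finally show ?thesis .
qed

lemma (in compact_Hausdorff_topology) topological_content_finitely_additive_probability:
  assumes l: "finitely_additive_probability \<Omega> l"
  shows "topological_content T (\<lambda>A. ennreal (l A))"
proof unfold_locales
  have add: "l (A \<union> B) = l A + l B" if "A \<inter> B = {}" for A B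
    using l that by (simp add: finitely_additive_probability_def)
  have pos: "0 \<le> l A" for A
    using l by (simp add: finitely_additive_probability_def)
  note mono = finitely_additive_probability_mono[OF l]
  show "ennreal (l {}) = 0" using add[of "{}" "{}"] by simp
  show "ennreal (l K) \<le> ennreal (l L)" if "K \<subseteq> L" for K L
    using mono[OF that] by (rule ennreal_leI)
  show "ennreal (l (K \<union> L)) = ennreal (l K) + ennreal (l L)" if "K \<inter> L = {}" for K L
    using add[OF that] pos by simp
  show "ennreal (l (K \<union> L)) \<le> ennreal (l K) + ennreal (l L)" for K L
    using add[of K "L - K"] mono[of "L - K" L] pos by (simp add: ennreal_plus[symmetric] del: ennreal_plus)
qed

section \<open>Covers by translates\<close>

lemma l_coset_eq_image: "g <#\<^bsub>G\<^esub> A = (\<lambda>x. g \<otimes>\<^bsub>G\<^esub> x) ` A"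
  by (auto simp: l_coset_def)

context group
begin

lemma mem_l_coset_iff:
  assumes g: "g \<in> carrier G" and A: "A \<subseteq> carrier G"
  shows "x \<in> g <# A \<longleftrightarrow> x \<in> carrier G \<and> inv g \<otimes> x \<in> A"
proof
  assume "x \<in> g <# A"
  then obtain a where "a \<in> A" "x = g \<otimes> a" by (auto simp: l_coset_def)
  then show "x \<in> carrier G \<and> inv g \<otimes> x \<in> A"
    using g A by (auto simp: m_assoc[symmetric] subset_iff)
next
  assume x: "x \<in> carrier G \<and> inv g \<otimes> x \<in> A"
  then have "x = g \<otimes> (inv g \<otimes> x)" using g by (simp add: m_assoc[symmetric])
  then show "x \<in> g <# A" using x unfolding l_coset_eq_image by blast
qed

lemma l_coset_inv_cancel:
  "g \<in> carrier G \<Longrightarrow> A \<subseteq> carrier G \<Longrightarrow> inv g <# (g <# A) = A"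
  by (simp add: lcos_m_assoc lcos_mult_one)

lemma mem_set_inv_iff:
  assumes "A \<subseteq> carrier G" "x \<in> carrier G"
  shows "x \<in> set_inv A \<longleftrightarrow> inv x \<in> A"
  using assms inv_inv unfolding SET_INV_def by force

lemma card_l_coset_Int:
  assumes "g \<in> carrier G" "A \<subseteq> carrier G"
  shows "card ((g <# A) \<inter> S) = card {a \<in> A. g \<otimes> a \<in> S}"
proof -
  have "(g <# A) \<inter> S = (\<lambda>a. g \<otimes> a) ` {a \<in> A. g \<otimes> a \<in> S}" by (auto simp: l_coset_eq_image)
  moreover have "inj_on (\<lambda>a. g \<otimes> a) {a \<in> A. g \<otimes> a \<in> S}"
    using assms by (auto simp: inj_on_def subset_iff)
  ultimately show ?thesis by (simp add: card_image)
qed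

lemma card_translates_containing:
  assumes g: "g \<in> carrier G" and A: "A \<subseteq> carrier G" and S: "S \<subseteq> carrier G"
  shows "card {a \<in> A. g \<in> a <# S} = card ((inv g <# A) \<inter> set_inv S)"
proof -
  have "g \<in> a <# S \<longleftrightarrow> inv g \<otimes> a \<in> set_inv S" if "a \<in> A" for a
  proof -
    have a: "a \<in> carrier G" using that A by auto
    show ?thesis
      using mem_set_inv_iff[OF S, of "inv g \<otimes> a"] a g by (simp add: mem_l_coset_iff[OF a S] inv_mult_group)
  qed
  then have "{a \<in> A. g \<in> a <# S} = {a \<in> A. inv g \<otimes> a \<in> set_inv S}" by blast
  then show ?thesis using card_l_coset_Int[of "inv g" A] g A by simp
qed

definition translate_cover :: "'a set \<Rightarrow> 'a set \<Rightarrow> bool" where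
  "translate_cover V A \<longleftrightarrow> finite A \<and> A \<subseteq> carrier G \<and> carrier G \<subseteq> A <#> V"

definition minimal_translate_cover :: "'a set \<Rightarrow> 'a set \<Rightarrow> bool" where
  "minimal_translate_cover V A \<longleftrightarrow> translate_cover V A \<and> (\<forall>B. translate_cover V B \<longrightarrow> card A \<le> card B)"

lemma translate_cover_l_coset:
  assumes g: "g \<in> carrier G" and V: "V \<subseteq> carrier G" and A: "translate_cover V A"
  shows "translate_cover V (g <# A)"
  unfolding translate_cover_def
proof (intro conjI)
  have AG: "A \<subseteq> carrier G" using A by (simp add: translate_cover_def)
  show "g <# A \<subseteq> carrier G" by (rule l_coset_subset_G[OF AG g])
  show "finite (g <# A)" using A by (simp add: translate_cover_def l_coset_eq_image)
  have "A <#> V = carrier G"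
    using A setmult_subset_G[OF AG V] by (simp add: translate_cover_def equalityI)
  then have "(g <# A) <#> V = g <# carrier G"
    by (simp only: setmult_lcos_assoc[OF AG V g])
  moreover have "carrier G \<subseteq> g <# carrier G"
    using g by (auto simp: mem_l_coset_iff)
  ultimately show "carrier G \<subseteq> (g <# A) <#> V" by (simp only:)
qed

text \<open>Otherwise trading \<open>A \<inter> K\<close> for \<open>B \<inter> U\<close> would give a smaller cover.\<close>

lemma minimal_translate_cover_exchange:
  assumes A: "minimal_translate_cover V A" and B: "translate_cover V B"
    and V: "V \<subseteq> carrier G" and KU: "K <#> V <#> set_inv V \<subseteq> U"
  shows "card (A \<inter> K) \<le> card (B \<inter> U)"
proof -
  have finite_AB: "finite A" "finite B" and AG: "A \<subseteq> carrier G" and BG: "B \<subseteq> carrier G"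
    using A B by (auto simp: minimal_translate_cover_def translate_cover_def)
  have "translate_cover V ((A - K) \<union> (B \<inter> U))"
    unfolding translate_cover_def
  proof (intro conjI subsetI)
    fix x assume "x \<in> carrier G"
    then have "x \<in> A <#> V" "x \<in> B <#> V"
      using A B by (auto simp: minimal_translate_cover_def translate_cover_def)
    then obtain a v b w where a: "a \<in> A" "v \<in> V" "x = a \<otimes> v" and b: "b \<in> B" "w \<in> V" "x = b \<otimes> w"
      by (auto simp: set_mult_def)
    have "b \<in> U" if "a \<in> K"
    proof -
      have "b = a \<otimes> v \<otimes> inv w"
        using a b AG BG V by (subst inv_solve_right) (auto simp: subset_iff)
      moreover have "a \<otimes> v \<otimes> inv w \<in> K <#> V <#> set_inv V"
        using a b that unfolding set_mult_def SET_INV_def by blast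
      ultimately show ?thesis using KU by blast
    qed
    then show "x \<in> ((A - K) \<union> (B \<inter> U)) <#> V"
      using a b unfolding set_mult_def by blast
  qed (use finite_AB AG BG in auto)
  then have "card A \<le> card ((A - K) \<union> (B \<inter> U))"
    using A by (simp add: minimal_translate_cover_def)
  also have "\<dots> \<le> card (A - K) + card (B \<inter> U)" by (rule card_Un_le)
  finally show ?thesis using card_Int_Diff[OF finite_AB(1), of K] by linarith
qed

lemma minimal_translate_cover_card_le:
  assumes A: "minimal_translate_cover V A" and V: "V \<subseteq> carrier G"
    and KU: "K <#> V <#> set_inv V \<subseteq> U" and g: "g \<in> carrier G" and h: "h \<in> carrier G"
  shows "card ((g <# A) \<inter> K) \<le> card ((h <# A) \<inter> U)"
proof (rule minimal_translate_cover_exchange[OF _ _ V KU])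
  have cover: "translate_cover V A" and AG: "A \<subseteq> carrier G"
    using A by (auto simp: minimal_translate_cover_def translate_cover_def)
  show "translate_cover V (h <# A)" by (rule translate_cover_l_coset[OF h V cover])
  have "card (g <# A) = card A" using card_l_coset_Int[OF g AG, of UNIV] by simp
  then show "minimal_translate_cover V (g <# A)"
    using A translate_cover_l_coset[OF g V cover] by (simp add: minimal_translate_cover_def)
qed

end

section \<open>Compact groups\<close>

locale compact_topological_group =
  fixes G :: "('a, 'b) monoid_scheme" (structure) and T :: "'a topology"
  assumes compact_group: "compact_group G T"
begin

sublocale group G
  using compact_group by (simp add: compact_group_def)

sublocale compact_Hausdorff_topology T
  using compact_group by unfold_locales (simp_all add: compact_group_def)

lemma topspace_eq_carrier [simp]: "topspace T = carrier G"
  using compact_group by (simp add: compact_group_def)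

lemma openin_carrier [simp]: "openin T (carrier G)"
  using openin_topspace[of T] by simp

lemma openin_subset_carrier: "openin T U \<Longrightarrow> U \<subseteq> carrier G"
  using openin_subset[of T U] by simp

lemma closedin_subset_carrier: "closedin T K \<Longrightarrow> K \<subseteq> carrier G"
  using closedin_subset[of T K] by simp

lemma borel_subset_carrier: "A \<in> sets (borel_of T) \<Longrightarrow> A \<subseteq> carrier G"
  using sets.sets_into_space[of A "borel_of T"] by simp

lemma continuous_map_mult:
  assumes "continuous_map S T f" "continuous_map S T g"
  shows "continuous_map S T (\<lambda>x. f x \<otimes> g x)"
proof -
  have "continuous_map S T ((\<lambda>(x, y). x \<otimes> y) \<circ> (\<lambda>x. (f x, g x)))"
    using compact_group assms
    by (intro continuous_map_compose[where X' = "prod_topology T T"])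
      (auto simp: compact_group_def continuous_map_pairwise comp_def)
  then show ?thesis by (simp add: comp_def)
qed

lemma continuous_map_inv:
  assumes "continuous_map S T f"
  shows "continuous_map S T (\<lambda>x. inv (f x))"
  using continuous_map_compose[OF assms, of T "\<lambda>x. inv x"] compact_group
  by (simp add: compact_group_def comp_def)

lemma homeomorphic_map_translation:
  assumes g: "g \<in> carrier G"
  shows "homeomorphic_map T T (\<lambda>x. g \<otimes> x)"
proof -
  have "continuous_map T T (\<lambda>x. h \<otimes> x)" if "h \<in> carrier G" for h
    using that by (intro continuous_map_mult) auto
  then show ?thesis
    using g by (intro homeomorphic_maps_imp_map[of _ _ _ "\<lambda>x. inv g \<otimes> x"])
      (auto simp: homeomorphic_maps_def m_assoc[symmetric])
qed

lemma homeomorphic_map_inv: "homeomorphic_map T T (\<lambda>x. inv x)"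
  by (intro homeomorphic_maps_imp_map[of _ _ _ "\<lambda>x. inv x"])
    (auto simp: homeomorphic_maps_def continuous_map_inv)

lemma openin_l_coset: "g \<in> carrier G \<Longrightarrow> openin T U \<Longrightarrow> openin T (g <# U)"
  using homeomorphic_map_openness[OF homeomorphic_map_translation, of g U] openin_subset_carrier
  by (simp add: l_coset_eq_image)

lemma borel_l_coset:
  assumes g: "g \<in> carrier G" and A: "A \<in> sets (borel_of T)"
  shows "g <# A \<in> sets (borel_of T)"
proof -
  have "continuous_map T T (\<lambda>x. inv g \<otimes> x)"
    using g by (intro homeomorphic_imp_continuous_map homeomorphic_map_translation) simp
  from vimage_in_sets_borel_of[OF this A]
  have "(\<lambda>x. inv g \<otimes> x) -` A \<inter> carrier G \<in> sets (borel_of T)" by simp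
  also have "(\<lambda>x. inv g \<otimes> x) -` A \<inter> carrier G = g <# A"
    using g borel_subset_carrier[OF A] by (auto simp: mem_l_coset_iff)
  finally show ?thesis .
qed

lemma closedin_set_mult:
  assumes "closedin T A" "closedin T B"
  shows "closedin T (A <#> B)"
proof -
  have "compactin (prod_topology T T) (A \<times> B)"
    using assms by (simp add: compactin_Times compactin_iff_closedin)
  moreover have "continuous_map (prod_topology T T) T (\<lambda>z. fst z \<otimes> snd z)"
    by (intro continuous_map_mult continuous_map_fst continuous_map_snd)
  ultimately have "compactin T ((\<lambda>z. fst z \<otimes> snd z) ` (A \<times> B))"
    by (rule image_compactin)
  also have "(\<lambda>z. fst z \<otimes> snd z) ` (A \<times> B) = A <#> B"
    unfolding set_mult_def by force
  finally show ?thesis by (simp add: compactin_iff_closedin)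
qed

lemma uniform_neighbourhood:
  assumes K: "closedin T K" and U: "openin T U" "K \<subseteq> U"
  shows "\<exists>V. openin T V \<and> \<one> \<in> V \<and> K <#> V <#> set_inv V \<subseteq> U"
proof -
  let ?P = "prod_topology T (prod_topology T T)"
  let ?f = "\<lambda>p. fst p \<otimes> fst (snd p) \<otimes> inv (snd (snd p))"
  have "continuous_map ?P T ?f"
    by (intro continuous_map_mult continuous_map_inv continuous_map_fst
        continuous_map_compose[OF continuous_map_snd continuous_map_fst, unfolded comp_def]
        continuous_map_compose[OF continuous_map_snd continuous_map_snd, unfolded comp_def])
  then have W: "openin ?P {p \<in> topspace ?P. ?f p \<in> U}" (is "openin ?P ?W")
    using U(1) by (rule openin_continuous_map_preimage)
  have "K \<times> {(\<one>, \<one>)} \<subseteq> ?W" using closedin_subset_carrier[OF K] U(2) by (auto simp: subset_iff)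
  then obtain A B where AB: "openin T A" "openin (prod_topology T T) B" "K \<subseteq> A" "{(\<one>, \<one>)} \<subseteq> B"
      "A \<times> B \<subseteq> ?W"
    by (rule Wallace_theorem_prod_topology[OF _ _ W, rotated 2])
      (use K in \<open>auto simp: compactin_iff_closedin\<close>)
  then obtain V1 V2 where V: "openin T V1" "openin T V2" "\<one> \<in> V1" "\<one> \<in> V2" "V1 \<times> V2 \<subseteq> B"
    by (force simp: openin_prod_topology_alt)
  have "x \<otimes> v \<otimes> inv w \<in> U" if "x \<in> K" "v \<in> V1 \<inter> V2" "w \<in> V1 \<inter> V2" for x v w
  proof -
    have "(x, v, w) \<in> ?W" using that AB V by blast
    then show ?thesis by simp
  qed
  then have "K <#> (V1 \<inter> V2) <#> set_inv (V1 \<inter> V2) \<subseteq> U"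
    unfolding set_mult_def SET_INV_def by blast
  then show ?thesis using V by (intro exI[of _ "V1 \<inter> V2"]) auto
qed

lemma minimal_translate_cover_exists:
  assumes V: "openin T V" "\<one> \<in> V"
  shows "\<exists>A. minimal_translate_cover V A"
proof -
  have "carrier G \<subseteq> (\<Union>a\<in>carrier G. a <# V)" using V(2) by (force simp: l_coset_def)
  moreover have "compactin T (carrier G)" using compact_space by (simp add: compact_space_def)
  moreover have "\<forall>U\<in>(\<lambda>a. a <# V) ` carrier G. openin T U" using openin_l_coset V(1) by blast
  ultimately obtain \<F> where \<F>: "finite \<F>" "\<F> \<subseteq> (\<lambda>a. a <# V) ` carrier G" "carrier G \<subseteq> \<Union>\<F>"
    unfolding compactin_def by meson
  then obtain A where A: "finite A" "A \<subseteq> carrier G" "\<F> = (\<lambda>a. a <# V) ` A"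
    by (meson finite_subset_image)
  moreover have "(\<Union>a\<in>A. a <# V) = A <#> V" by (simp add: l_coset_def set_mult_def)
  ultimately have "translate_cover V A" using \<F>(3) by (simp add: translate_cover_def)
  then show ?thesis
    unfolding minimal_translate_cover_def by (rule ex_has_least_nat)
qed

lemma minimal_translate_coverD:
  assumes "minimal_translate_cover V A"
  shows "finite A" "A \<noteq> {}" "A \<subseteq> carrier G"
  using assms one_closed by (auto simp: minimal_translate_cover_def translate_cover_def set_mult_def)

text \<open>
  Passing to inverses turns the points of \<open>g\<inverse> A\<close> in \<open>K\<inverse>\<close> into the left translates of \<open>K\<close> by elements
  of \<open>A\<close> that contain \<open>g\<close>; left invariance gives the integral of their number.
\<close>

lemma equidistributed_translates_exist:
  assumes K: "closedin T K" and U: "openin T U" "K \<subseteq> U"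
  shows "\<exists>A. finite A \<and> A \<noteq> {} \<and> A \<subseteq> carrier G \<and>
    (\<forall>g\<in>carrier G. \<forall>h\<in>carrier G. card {a \<in> A. g \<in> a <# K} \<le> card {a \<in> A. h \<in> a <# U})"
proof -
  have set_inv_image: "set_inv S = (\<lambda>x. inv x) ` S" for S by (auto simp: SET_INV_def)
  have KG: "K \<subseteq> carrier G" and UG: "U \<subseteq> carrier G"
    using K U(1) closedin_subset_carrier openin_subset_carrier by auto
  have "closedin T (set_inv K)" "openin T (set_inv U)" "set_inv K \<subseteq> set_inv U"
    using K U KG UG homeomorphic_map_closedness[OF homeomorphic_map_inv, of K]
      homeomorphic_map_openness[OF homeomorphic_map_inv, of U]
    by (auto simp: set_inv_image)
  then obtain V where V: "openin T V" "\<one> \<in> V" and KU: "set_inv K <#> V <#> set_inv V \<subseteq> set_inv U"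
    using uniform_neighbourhood by meson
  obtain A where A: "minimal_translate_cover V A" using minimal_translate_cover_exists[OF V] by blast
  have "card {a \<in> A. g \<in> a <# K} \<le> card {a \<in> A. h \<in> a <# U}"
    if "g \<in> carrier G" "h \<in> carrier G" for g h
    using that minimal_translate_coverD(3)[OF A] KG UG
      minimal_translate_cover_card_le[OF A openin_subset_carrier[OF V(1)] KU, of "inv g" "inv h"]
    by (simp add: card_translates_containing)
  then show ?thesis using minimal_translate_coverD[OF A] by blast
qed

end

section \<open>Haar measure\<close>

context compact_topological_group
begin

lemma is_haar_iff:
  "is_haar G T \<mu> \<longleftrightarrow> regular_borel_measure T \<mu> \<and> emeasure \<mu> (carrier G) = 1
     \<and> (\<forall>g\<in>carrier G. \<forall>A\<in>sets (borel_of T). emeasure \<mu> (g <# A) = emeasure \<mu> A)"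
proof
  assume "is_haar G T \<mu>"
  then show "regular_borel_measure T \<mu> \<and> emeasure \<mu> (carrier G) = 1
     \<and> (\<forall>g\<in>carrier G. \<forall>A\<in>sets (borel_of T). emeasure \<mu> (g <# A) = emeasure \<mu> A)"
    unfolding is_haar_def regular_borel_measure_def sets_borel_of l_coset_eq_image topspace_eq_carrier
    by (elim conjE) (intro conjI, simp_all only:)
next
  assume \<mu>: "regular_borel_measure T \<mu> \<and> emeasure \<mu> (carrier G) = 1
     \<and> (\<forall>g\<in>carrier G. \<forall>A\<in>sets (borel_of T). emeasure \<mu> (g <# A) = emeasure \<mu> A)"
  have space: "space \<mu> = carrier G"
    using \<mu> regular_borel_measure_space[of T \<mu>] by simp
  show "is_haar G T \<mu>"
    using \<mu> unfolding is_haar_def regular_borel_measure_def sets_borel_of l_coset_eq_image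
      topspace_eq_carrier space
    by (elim conjE) (intro conjI, simp_all only:)
qed

context
  fixes \<mu> assumes \<mu>: "is_haar G T \<mu>"
begin

lemma haar_regular: "regular_borel_measure T \<mu>"
  and haar_carrier: "emeasure \<mu> (carrier G) = 1"
  and haar_l_coset: "g \<in> carrier G \<Longrightarrow> A \<in> sets (borel_of T) \<Longrightarrow> emeasure \<mu> (g <# A) = emeasure \<mu> A"
  using \<mu> unfolding is_haar_iff by auto

lemma haar_space: "space \<mu> = carrier G"
  using regular_borel_measure_space[OF haar_regular] by simp

lemma haar_sets: "sets \<mu> = sets (borel_of T)"
  by (rule regular_borel_measure_sets[OF haar_regular])

lemma nn_integral_card_translates:
  assumes A: "finite A" "A \<subseteq> carrier G" and S: "S \<in> sets (borel_of T)"
  shows "(\<integral>\<^sup>+x. of_nat (card {a \<in> A. x \<in> a <# S}) \<partial>\<mu>) = of_nat (card A) * emeasure \<mu> S"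
proof -
  have translate: "a <# S \<in> sets \<mu>" if "a \<in> A" for a
    using that A S borel_l_coset by (auto simp: haar_sets)
  have "of_nat (card {a \<in> A. x \<in> a <# S}) = (\<Sum>a\<in>A. indicator (a <# S) x :: ennreal)" for x
    using A(1) by (simp add: indicator_def sum.If_cases Int_def)
  then have "(\<integral>\<^sup>+x. of_nat (card {a \<in> A. x \<in> a <# S}) \<partial>\<mu>) = (\<Sum>a\<in>A. (\<integral>\<^sup>+x. indicator (a <# S) x \<partial>\<mu>))"
    using translate by (simp add: nn_integral_sum)
  also have "\<dots> = (\<Sum>a\<in>A. emeasure \<mu> S)"
    using translate A S haar_l_coset by (intro sum.cong) auto
  finally show ?thesis by simp
qed

end

lemma haar_le_on_closed:
  assumes \<mu>: "is_haar G T \<mu>" and \<nu>: "is_haar G T \<nu>" and K: "closedin T K"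
  shows "emeasure \<mu> K \<le> emeasure \<nu> K"
  unfolding regular_borel_measure_outer[OF haar_regular[OF \<nu>] closedin_in_sets_borel_of[OF K]]
proof (rule INF_greatest, clarify)
  fix U assume U: "openin T U" "K \<subseteq> U"
  obtain A where A: "finite A" "A \<noteq> {}" "A \<subseteq> carrier G"
    and count_le: "\<And>g h. g \<in> carrier G \<Longrightarrow> h \<in> carrier G \<Longrightarrow>
      card {a \<in> A. g \<in> a <# K} \<le> card {a \<in> A. h \<in> a <# U}"
    using equidistributed_translates_exist[OF K U] by auto
  have "of_nat (card A) * emeasure \<mu> K \<le> of_nat (card {a \<in> A. h \<in> a <# U})"
    if h: "h \<in> carrier G" for h
  proof -
    have "of_nat (card A) * emeasure \<mu> K = (\<integral>\<^sup>+g. of_nat (card {a \<in> A. g \<in> a <# K}) \<partial>\<mu>)"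
      using nn_integral_card_translates[OF \<mu> A(1,3) closedin_in_sets_borel_of[OF K]] by simp
    also have "\<dots> \<le> (\<integral>\<^sup>+g. of_nat (card {a \<in> A. h \<in> a <# U}) \<partial>\<mu>)"
      using count_le[OF _ h] by (intro nn_integral_mono) (simp add: haar_space[OF \<mu>])
    also have "\<dots> = of_nat (card {a \<in> A. h \<in> a <# U})"
      by (simp add: haar_space[OF \<mu>] haar_carrier[OF \<mu>])
    finally show ?thesis .
  qed
  then have "(\<integral>\<^sup>+h. of_nat (card A) * emeasure \<mu> K \<partial>\<nu>)
      \<le> (\<integral>\<^sup>+h. of_nat (card {a \<in> A. h \<in> a <# U}) \<partial>\<nu>)"
    by (intro nn_integral_mono) (simp add: haar_space[OF \<nu>])
  then have "of_nat (card A) * emeasure \<mu> K \<le> of_nat (card A) * emeasure \<nu> U"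
    using nn_integral_card_translates[OF \<nu> A(1,3) openin_in_sets_borel_of[OF U(1)]]
    by (simp add: haar_space[OF \<nu>] haar_carrier[OF \<nu>])
  then show "emeasure \<mu> K \<le> emeasure \<nu> U"
    using A by (subst (asm) ennreal_mult_le_mult_iff) auto
qed

theorem haar_unique: "is_haar G T \<mu> \<Longrightarrow> is_haar G T \<nu> \<Longrightarrow> \<mu> = \<nu>"
  by (rule regular_borel_measure_eqI[OF haar_regular haar_regular])
    (auto simp: compactin_iff_closedin intro!: antisym haar_le_on_closed)

end

definition (in group) approx_invariant :: "'a set \<Rightarrow> ('a set \<Rightarrow> real) \<Rightarrow> bool" where
  "approx_invariant V l \<longleftrightarrow>
     (\<forall>g\<in>carrier G. \<forall>K U. K \<subseteq> carrier G \<and> K <#> V <#> set_inv V \<subseteq> U \<longrightarrow> l (g <# K) \<le> l U)"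

lemma (in group) approx_invariant_mono:
  assumes "approx_invariant V l" "V \<subseteq> W"
  shows "approx_invariant W l"
proof -
  have "K <#> V <#> set_inv V \<subseteq> K <#> W <#> set_inv W" for K
    using assms(2) by (intro mono_set_mult) (auto simp: SET_INV_def)
  then show ?thesis using assms(1) unfolding approx_invariant_def by (meson subset_trans)
qed

lemma (in group) closed_approx_invariant: "closed {l. approx_invariant V l}"
  unfolding approx_invariant_def Ball_def
  by (intro closed_Collect_all closed_Collect_imp closed_Collect_le open_Collect_const
      continuous_on_product_coordinates)

context compact_topological_group
begin

lemma approx_invariant_probability_exists:
  assumes V: "openin T V" "\<one> \<in> V"
  shows "\<exists>l. finitely_additive_probability (carrier G) l \<and> approx_invariant V l"
proof -
  obtain A where A: "minimal_translate_cover V A" using minimal_translate_cover_exists[OF V] by blast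
  note A_cover = minimal_translate_coverD[OF A]
  define l where "l S = real (card (A \<inter> S)) / real (card A)" for S
  have card_pos: "card A > 0" using A_cover by (simp add: card_gt_0_iff)
  have "card (A \<inter> (S \<union> S')) = card (A \<inter> S) + card (A \<inter> S')" if "S \<inter> S' = {}" for S S'
    unfolding Int_Un_distrib using that A_cover(1) by (intro card_Un_disjoint) auto
  then have "finitely_additive_probability (carrier G) l"
    unfolding finitely_additive_probability_def l_def using A_cover card_pos card_mono[of A]
    by (auto simp: divide_le_eq Int_absorb2 add_divide_distrib)
  moreover have "approx_invariant V l"
    unfolding approx_invariant_def
  proof (intro ballI allI impI)
    fix g K U assume g: "g \<in> carrier G" and KU: "K \<subseteq> carrier G \<and> K <#> V <#> set_inv V \<subseteq> U"
    have "A \<inter> (g <# K) = {a \<in> A. inv g \<otimes> a \<in> K}"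
      using g KU A_cover(3) by (auto simp: mem_l_coset_iff)
    then have "card (A \<inter> (g <# K)) = card ((inv g <# A) \<inter> K)"
      using g A_cover(3) by (simp add: card_l_coset_Int)
    also have "\<dots> \<le> card ((\<one> <# A) \<inter> U)"
      using minimal_translate_cover_card_le[OF A openin_subset_carrier[OF V(1)]] g KU by simp
    finally show "l (g <# K) \<le> l U"
      using A_cover(3) by (simp add: l_def lcos_mult_one divide_right_mono)
  qed
  ultimately show ?thesis by blast
qed

lemma invariant_probability_exists:
  "\<exists>l. finitely_additive_probability (carrier G) l \<and>
     (\<forall>g\<in>carrier G. \<forall>K U. closedin T K \<longrightarrow> openin T U \<longrightarrow> K \<subseteq> U \<longrightarrow> l (g <# K) \<le> l U)"
proof -
  let ?N = "{V. openin T V \<and> \<one> \<in> V}" and ?C = "\<lambda>V. {l. approx_invariant V l}"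
  let ?P = "{l. finitely_additive_probability (carrier G) l}"
  have "?P \<inter> \<Inter>(?C ` ?N) \<noteq> {}"
  proof (rule compact_imp_fip[OF compact_finitely_additive_probability])
    show "closed S" if "S \<in> ?C ` ?N" for S using that closed_approx_invariant by auto
    fix \<F> assume "finite \<F>" "\<F> \<subseteq> ?C ` ?N"
    then obtain \<V> where \<V>: "finite \<V>" "\<V> \<subseteq> ?N" "\<F> = ?C ` \<V>" by (meson finite_subset_image)
    have "openin T (carrier G \<inter> \<Inter>\<V>)"
      using \<V> openin_Int_Inter[of \<V> T "carrier G"] by auto
    moreover have "\<one> \<in> carrier G \<inter> \<Inter>\<V>" using \<V> by auto
    ultimately obtain l where l: "l \<in> ?P" "approx_invariant (carrier G \<inter> \<Inter>\<V>) l"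
      using approx_invariant_probability_exists by blast
    have "approx_invariant V l" if "V \<in> \<V>" for V
      using approx_invariant_mono[OF l(2)] that by blast
    then show "?P \<inter> \<Inter>\<F> \<noteq> {}" using l(1) \<V>(3) by blast
  qed
  then obtain l where l: "finitely_additive_probability (carrier G) l"
    and approx: "\<And>V. openin T V \<Longrightarrow> \<one> \<in> V \<Longrightarrow> approx_invariant V l" by auto
  have "l (g <# K) \<le> l U" if "g \<in> carrier G" "closedin T K" "openin T U" "K \<subseteq> U" for g K U
    using uniform_neighbourhood[OF that(2-4)] approx that(1) closedin_subset_carrier[OF that(2)]
    unfolding approx_invariant_def by blast
  then show ?thesis using l by blast
qed

theorem haar_exists: "\<exists>\<mu>. is_haar G T \<mu>"
proof -
  obtain l where l: "finitely_additive_probability (carrier G) l"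
    and invariant: "\<And>g K U. g \<in> carrier G \<Longrightarrow> closedin T K \<Longrightarrow> openin T U \<Longrightarrow> K \<subseteq> U \<Longrightarrow> l (g <# K) \<le> l U"
    using invariant_probability_exists by auto
  interpret C: topological_content T "\<lambda>A. ennreal (l A)"
    by (rule topological_content_finitely_additive_probability[OF l])
  have outer_le: "C.outer_content (g <# A) \<le> C.outer_content A" if g: "g \<in> carrier G" for g A
    unfolding l_coset_eq_image
  proof (rule C.outer_content_homeomorphic_image_le[OF homeomorphic_map_translation[OF g]])
    fix K U L assume "closedin T K" "openin T U" "K \<subseteq> U" "U \<subseteq> L"
    then have "l (g <# K) \<le> l U" "l U \<le> l L"
      using invariant[OF g] finitely_additive_probability_mono[OF l] by simp_all
    then have "l (g <# K) \<le> l L" by (rule order_trans)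
    then show "ennreal (l ((\<lambda>x. g \<otimes> x) ` K)) \<le> ennreal (l L)"
      by (simp add: l_coset_eq_image ennreal_leI)
  qed
  have "emeasure C.content_measure (g <# A) = emeasure C.content_measure A"
    if g: "g \<in> carrier G" and A: "A \<in> sets (borel_of T)" for g A
  proof -
    have "C.outer_content (inv g <# (g <# A)) \<le> C.outer_content (g <# A)"
      using g by (intro outer_le) simp
    then have "C.outer_content (g <# A) = C.outer_content A"
      using outer_le[OF g, of A] g borel_subset_carrier[OF A] by (simp add: l_coset_inv_cancel)
    then show ?thesis
      by (simp only: C.emeasure_content_measure[OF A] C.emeasure_content_measure[OF borel_l_coset[OF g A]])
  qed
  moreover have "emeasure C.content_measure (carrier G) = 1"
    using C.emeasure_content_measure_topspace l by (simp add: finitely_additive_probability_def)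
  ultimately have "is_haar G T C.content_measure"
    unfolding is_haar_iff using C.regular_borel_measure_content_measure by blast
  then show ?thesis ..
qed

lemma haar_measure_eqI: "is_haar G T \<mu> \<Longrightarrow> haar_measure G T = \<mu>"
  unfolding haar_measure_def using haar_unique by blast

lemma is_haar_haar_measure: "is_haar G T (haar_measure G T)"
  using haar_exists haar_measure_eqI by metis

end

section \<open>Homomorphic images, products and quotients of compact groups\<close>

lemma is_haar_distr:
  fixes G (structure)
  assumes G: "compact_group G T" and H: "compact_group H S"
    and hom: "\<phi> \<in> hom G H" and surj: "\<phi> ` carrier G = carrier H" and cont: "continuous_map T S \<phi>"
    and \<mu>: "is_haar G T \<mu>"
  shows "is_haar H S (distr \<mu> (borel_of S) \<phi>)" (is "is_haar H S ?\<nu>")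
proof -
  interpret G: compact_topological_group G T using G by unfold_locales
  interpret H: compact_topological_group H S using H by unfold_locales
  interpret \<phi>: group_hom G H \<phi> using hom by unfold_locales
  have emeasure_\<nu>: "emeasure ?\<nu> A = emeasure \<mu> (\<phi> -` A \<inter> carrier G)" if "A \<in> sets (borel_of S)" for A
    using emeasure_distr_regular_borel_measure[OF G.haar_regular[OF \<mu>] cont that] by simp
  have "regular_borel_measure S ?\<nu>"
    using G.haar_regular[OF \<mu>] cont G.compact_space H.Hausdorff_space
    by (intro regular_borel_measure_distr T1_Spaces.continuous_imp_closed_map)
  moreover have "emeasure ?\<nu> (carrier H) = 1"
  proof -
    have "\<phi> -` carrier H \<inter> carrier G = carrier G" by auto
    then show ?thesis using G.haar_carrier[OF \<mu>] by (simp add: emeasure_\<nu> openin_in_sets_borel_of)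
  qed
  moreover have "emeasure ?\<nu> (h <#\<^bsub>H\<^esub> A) = emeasure ?\<nu> A"
    if h: "h \<in> carrier H" and A: "A \<in> sets (borel_of S)" for h A
  proof -
    obtain g where g: "g \<in> carrier G" "h = \<phi> g" using h surj by blast
    have "\<phi> -` A \<inter> carrier G \<in> sets (borel_of T)"
      using vimage_in_sets_borel_of[OF cont A] by simp
    then have "emeasure \<mu> (\<phi> -` A \<inter> carrier G) = emeasure \<mu> (g <# (\<phi> -` A \<inter> carrier G))"
      by (rule G.haar_l_coset[OF \<mu> g(1), symmetric])
    also have "g <# (\<phi> -` A \<inter> carrier G) = \<phi> -` (h <#\<^bsub>H\<^esub> A) \<inter> carrier G"
      using g H.borel_subset_carrier[OF A] by (auto simp: G.mem_l_coset_iff H.mem_l_coset_iff)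
    finally show ?thesis by (simp add: emeasure_\<nu> A H.borel_l_coset[OF h A])
  qed
  ultimately show ?thesis unfolding H.is_haar_iff by blast
qed

lemma compact_group_product:
  assumes "\<And>i. i \<in> I \<Longrightarrow> compact_group (G i) (T i)"
  shows "compact_group (product_group I G) (product_topology T I)"
proof -
  have factor: "compact_topological_group (G i) (T i)" if "i \<in> I" for i
    using assms that by unfold_locales
  have group: "group (G i)" if "i \<in> I" for i
    using assms that by (simp add: compact_group_def)
  have topspace: "topspace (T i) = carrier (G i)" if "i \<in> I" for i
    using assms that by (simp add: compact_group_def)
  let ?T = "product_topology T I" and ?TT = "prod_topology (product_topology T I) (product_topology T I)"
  have topspace_product: "topspace ?T = carrier (product_group I G)"
    unfolding topspace_product_topology carrier_product_group by (rule PiE_cong) (rule topspace)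
  have mult: "continuous_map ?TT (T i) (\<lambda>z. fst z i \<otimes>\<^bsub>G i\<^esub> snd z i)" if "i \<in> I" for i
    using continuous_map_compose[OF continuous_map_fst continuous_map_product_projection[OF that]]
      continuous_map_compose[OF continuous_map_snd continuous_map_product_projection[OF that]]
    by (intro compact_topological_group.continuous_map_mult[OF factor[OF that]]) (simp_all only: comp_def)
  have "continuous_map ?TT ?T (\<lambda>z. \<lambda>i\<in>I. fst z i \<otimes>\<^bsub>G i\<^esub> snd z i)"
    unfolding continuous_map_componentwise by (simp add: mult image_subset_iff)
  then have "continuous_map ?TT ?T (\<lambda>(x, y). x \<otimes>\<^bsub>product_group I G\<^esub> y)"
    by (simp only: mult_product_group case_prod_unfold)
  moreover have inverse: "continuous_map ?T (T i) (\<lambda>x. inv\<^bsub>G i\<^esub> x i)" if "i \<in> I" for i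
    using that
    by (intro compact_topological_group.continuous_map_inv[OF factor] continuous_map_product_projection)
  have "continuous_map ?T ?T (\<lambda>x. \<lambda>i\<in>I. inv\<^bsub>G i\<^esub> x i)"
    unfolding continuous_map_componentwise by (simp add: inverse image_subset_iff)
  then have "continuous_map ?T ?T (\<lambda>x. inv\<^bsub>product_group I G\<^esub> x)"
    by (rule continuous_map_eq) (simp add: group topspace_product del: topspace_product_topology)
  ultimately show ?thesis
    using assms group topspace_product unfolding compact_group_def
    by (simp add: compact_space_product_topology Hausdorff_space_product_topology del: topspace_product_topology)
qed

lemma (in group) rcosets_eq_image: "rcosets N = (\<lambda>x. N #> x) ` carrier G"
  by (auto simp: RCOSETS_def)

context normal
begin

lemma group_hom_quotient: "group_hom G (G Mod H) (\<lambda>x. H #> x)"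
  using r_coset_hom_Mod factorgroup_is_group is_group by (simp add: group_hom_def group_hom_axioms_def)

lemma r_coset_eq_iff:
  assumes "x \<in> carrier G" "y \<in> carrier G"
  shows "H #> x = H #> y \<longleftrightarrow> x \<in> H #> y"
proof
  assume "H #> x = H #> y"
  then show "x \<in> H #> y" using rcos_self[OF assms(1) subgroup_axioms] by simp
next
  assume "x \<in> H #> y"
  then show "H #> x = H #> y" using repr_independence[OF _ assms(2) subgroup_axioms] by simp
qed

lemma kernel_quotient: "kernel G (G Mod H) (\<lambda>x. H #> x) = H"
proof -
  have "H #> x = H \<longleftrightarrow> x \<in> H" if "x \<in> carrier G" for x
    using coset_join1[OF _ that subgroup_axioms] coset_join2[OF that subgroup_axioms] by blast
  then show ?thesis using subset unfolding kernel_def one_FactGroup by blast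
qed

lemma Union_rcosets:
  assumes "\<U> \<subseteq> rcosets H"
  shows "\<Union>\<U> = {x \<in> carrier G. H #> x \<in> \<U>}"
proof (intro equalityI subsetI)
  fix x assume "x \<in> \<Union>\<U>"
  then obtain y where y: "y \<in> carrier G" "H #> y \<in> \<U>" "x \<in> H #> y"
    using assms by (auto simp: rcosets_eq_image)
  then have "x \<in> carrier G" using elemrcos_carrier[OF is_group] by blast
  moreover from this have "H #> x = H #> y" using y by (simp add: r_coset_eq_iff)
  ultimately show "x \<in> {x \<in> carrier G. H #> x \<in> \<U>}" using y(2) by simp
next
  fix x assume "x \<in> {x \<in> carrier G. H #> x \<in> \<U>}"
  then show "x \<in> \<Union>\<U>" using rcos_self[OF _ subgroup_axioms] by blast
qed

end

locale closed_normal_subgroup = compact_topological_group G T + normal N G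
  for G :: "('a, 'b) monoid_scheme" (structure) and T :: "'a topology" and N :: "'a set" +
  assumes closed: "closedin T N"
begin

abbreviation quotient_topology :: "'a set topology" where
  "quotient_topology \<equiv> quotient_top G T N"

abbreviation projection :: "'a \<Rightarrow> 'a set" where
  "projection x \<equiv> N #> x"

lemma openin_quotient_top:
  "openin quotient_topology \<U> \<longleftrightarrow> \<U> \<subseteq> rcosets N \<and> openin T {x \<in> carrier G. projection x \<in> \<U>}"
proof -
  have Union_eq: "(\<lambda>\<U>. \<U> \<subseteq> rcosets N \<and> openin T (\<Union>\<U>)) =
      (\<lambda>\<U>. \<U> \<subseteq> rcosets N \<and> openin T {x \<in> carrier G. projection x \<in> \<U>})" (is "_ = ?open")
    by (intro ext conj_cong refl) (simp add: Union_rcosets)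
  have "istopology ?open"
    unfolding istopology_def
  proof (intro conjI allI impI)
    fix A B assume A: "?open A" and B: "?open B"
    have "{x \<in> carrier G. projection x \<in> A \<inter> B} =
        {x \<in> carrier G. projection x \<in> A} \<inter> {x \<in> carrier G. projection x \<in> B}" by auto
    then show "openin T {x \<in> carrier G. projection x \<in> A \<inter> B}" using A B by auto
    show "A \<inter> B \<subseteq> rcosets N" using A by auto
  next
    fix \<K> assume \<K>: "\<forall>K\<in>\<K>. ?open K"
    have "{x \<in> carrier G. projection x \<in> \<Union>\<K>} = (\<Union>K\<in>\<K>. {x \<in> carrier G. projection x \<in> K})" by auto
    also have "openin T \<dots>" using \<K> by (intro openin_Union) auto
    finally show "openin T {x \<in> carrier G. projection x \<in> \<Union>\<K>}" .
    show "\<Union>\<K> \<subseteq> rcosets N" using \<K> by auto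
  qed
  then show ?thesis unfolding quotient_top_def Union_eq by simp
qed

lemma topspace_quotient_top: "topspace quotient_topology = rcosets N"
proof -
  have "{x \<in> carrier G. projection x \<in> rcosets N} = carrier G" by (auto simp: rcosets_eq_image)
  then have "openin quotient_topology (rcosets N)" by (simp add: openin_quotient_top)
  then show ?thesis unfolding topspace_def using openin_quotient_top by blast
qed

lemma quotient_map_projection: "quotient_map T quotient_topology projection"
  unfolding quotient_map_def
  by (simp add: topspace_quotient_top openin_quotient_top flip: rcosets_eq_image)

lemma closed_map_projection: "closed_map T quotient_topology projection"
  unfolding closed_map_def
proof (intro allI impI)
  fix K assume K: "closedin T K"
  then have KG: "K \<subseteq> carrier G" by (rule closedin_subset_carrier)
  have subset: "projection ` K \<subseteq> rcosets N" using KG by (auto simp: rcosets_eq_image)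
  have "{x \<in> carrier G. projection x \<in> projection ` K} = (\<Union>k\<in>K. projection k)"
    by (rule Union_rcosets[OF subset, symmetric])
  also have "\<dots> = N <#> K" by (auto simp: set_mult_def r_coset_def)
  finally have "closedin T {x \<in> topspace T. projection x \<in> projection ` K}"
    using closedin_set_mult[OF closed K] by simp
  then show "closedin quotient_topology (projection ` K)"
    using quotient_map_projection[unfolded quotient_map_closedin] subset
    by (simp add: topspace_quotient_top)
qed

lemma t1_space_quotient: "t1_space quotient_topology"
proof -
  have "closedin T {x}" if "x \<in> carrier G" for x
    using that Hausdorff_space by (simp add: closedin_Hausdorff_sing_eq)
  then have "closedin quotient_topology {projection x}" if "x \<in> carrier G" for x
    using closed_map_projection that unfolding closed_map_def by (metis image_empty image_insert)
  then show ?thesis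
    by (auto simp: t1_space_closedin_singleton topspace_quotient_top rcosets_eq_image)
qed

lemma perfect_map_projection: "perfect_map T quotient_topology projection"
  unfolding perfect_map_def
  using quotient_map_projection t1_space_quotient compact_space closed_map_projection
  by (intro conjI continuous_closed_imp_proper_map quotient_imp_continuous_map quotient_imp_surjective_map)

lemma compact_space_quotient: "compact_space quotient_topology"
  using image_compactin[OF _ quotient_imp_continuous_map[OF quotient_map_projection], of "topspace T"]
    compact_space quotient_imp_surjective_map[OF quotient_map_projection]
  by (simp add: compact_space_def)

lemma Hausdorff_space_quotient: "Hausdorff_space quotient_topology"
  by (intro normal_t1_imp_Hausdorff_space t1_space_quotient
      normal_space_perfect_map_image[OF normal_space perfect_map_projection])

lemma continuous_map_quotient_mult:
  "continuous_map (prod_topology quotient_topology quotient_topology) quotient_topology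
     (\<lambda>(A, B). A \<otimes>\<^bsub>G Mod N\<^esub> B)"
proof (rule continuous_compose_quotient_map)
  let ?p = "\<lambda>(x, y). (projection x, projection y)"
  have cont: "continuous_map T quotient_topology projection"
    by (rule quotient_imp_continuous_map[OF quotient_map_projection])
  show "quotient_map (prod_topology T T) (prod_topology quotient_topology quotient_topology) ?p"
  proof (rule continuous_closed_imp_quotient_map)
    show "continuous_map (prod_topology T T) (prod_topology quotient_topology quotient_topology) ?p"
      using cont by (simp add: continuous_map_prod_top)
    have "proper_map (prod_topology T T) (prod_topology quotient_topology quotient_topology) ?p"
      using perfect_map_projection by (simp add: proper_map_prod perfect_map_def)
    then show "closed_map (prod_topology T T) (prod_topology quotient_topology quotient_topology) ?p"
      by (simp add: proper_map_def)
    show "?p ` topspace (prod_topology T T) = topspace (prod_topology quotient_topology quotient_topology)"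
      using quotient_imp_surjective_map[OF quotient_map_projection] by (auto simp: image_paired_Times)
  qed
  have "continuous_map (prod_topology T T) quotient_topology (projection \<circ> (\<lambda>z. fst z \<otimes> snd z))"
    using cont by (intro continuous_map_compose[OF continuous_map_mult] continuous_map_fst continuous_map_snd)
  then show "continuous_map (prod_topology T T) quotient_topology ((\<lambda>(A, B). A \<otimes>\<^bsub>G Mod N\<^esub> B) \<circ> ?p)"
    by (rule continuous_map_eq) (auto simp: rcos_sum)
qed

lemma continuous_map_quotient_inv:
  "continuous_map quotient_topology quotient_topology (\<lambda>A. inv\<^bsub>G Mod N\<^esub> A)"
proof (rule continuous_compose_quotient_map[OF quotient_map_projection])
  interpret projection: group_hom G "G Mod N" projection by (rule group_hom_quotient)
  have "continuous_map T quotient_topology (projection \<circ> (\<lambda>x. inv x))"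
    using continuous_map_inv[of T "\<lambda>x. x"]
    by (intro continuous_map_compose[OF _ quotient_imp_continuous_map[OF quotient_map_projection]]) simp
  then show "continuous_map T quotient_topology ((\<lambda>A. inv\<^bsub>G Mod N\<^esub> A) \<circ> projection)"
    by (rule continuous_map_eq) simp
qed

lemma compact_group_quotient: "compact_group (G Mod N) quotient_topology"
  unfolding compact_group_def
  by (intro conjI factorgroup_is_group compact_space_quotient Hausdorff_space_quotient
      continuous_map_quotient_mult continuous_map_quotient_inv)
    (simp add: topspace_quotient_top carrier_FactGroup rcosets_eq_image)

end

section \<open>The upper central series\<close>

lemma (in group_hom) subgroup_vimage:
  assumes "subgroup K H"
  shows "subgroup {x \<in> carrier G. h x \<in> K} G"
proof -
  interpret K: subgroup K H by (rule assms)
  show ?thesis by (rule G.subgroupI) (auto intro: exI[of _ "\<one>\<^bsub>G\<^esub>"])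
qed

lemma (in group_hom) normal_vimage:
  assumes "K \<lhd> H"
  shows "{x \<in> carrier G. h x \<in> K} \<lhd> G"
proof -
  interpret K: normal K H by (rule assms)
  show ?thesis
    by (rule G.normal_invI[OF subgroup_vimage[OF K.subgroup_axioms]]) (auto intro: K.inv_op_closed2)
qed

definition centralizer :: "('a, 'b) monoid_scheme \<Rightarrow> 'a \<Rightarrow> 'a set" where
  "centralizer G x = {y \<in> carrier G. x \<otimes>\<^bsub>G\<^esub> y = y \<otimes>\<^bsub>G\<^esub> x}"

context group
begin

lemma subgroup_centralizer:
  assumes x: "x \<in> carrier G"
  shows "subgroup (centralizer G x) G"
proof (rule subgroupI)
  show "inv y \<in> centralizer G x" if "y \<in> centralizer G x" for y
  proof -
    have y: "y \<in> carrier G" "x \<otimes> y = y \<otimes> x" using that by (auto simp: centralizer_def)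
    then have "x = y \<otimes> (x \<otimes> inv y)" using x by (simp add: m_assoc[symmetric] inv_solve_right)
    then show ?thesis using x y by (simp add: centralizer_def inv_solve_left)
  qed
  show "y \<otimes> z \<in> centralizer G x" if "y \<in> centralizer G x" "z \<in> centralizer G x" for y z
  proof -
    have y: "y \<in> carrier G" "x \<otimes> y = y \<otimes> x" and z: "z \<in> carrier G" "x \<otimes> z = z \<otimes> x"
      using that by (auto simp: centralizer_def)
    have "x \<otimes> (y \<otimes> z) = y \<otimes> (x \<otimes> z)" using x y z(1) by (simp add: m_assoc[symmetric])
    also have "\<dots> = y \<otimes> z \<otimes> x" using x y(1) z by (simp add: m_assoc)
    finally show ?thesis using y(1) z(1) by (simp add: centralizer_def)
  qed
  show "centralizer G x \<subseteq> carrier G" "centralizer G x \<noteq> {}"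
    using x by (auto simp: centralizer_def)
qed

lemma group_center_eq_Inter_centralizer: "group_center G = (\<Inter>x\<in>carrier G. centralizer G x)"
  using one_closed by (auto simp: group_center_def centralizer_def simp del: one_closed)

lemma normal_group_center: "group_center G \<lhd> G"
proof (rule normal_invI)
  show "subgroup (group_center G) G"
    unfolding group_center_eq_Inter_centralizer by (rule subgroups_Inter) (auto intro: subgroup_centralizer)
  show "x \<otimes> z \<otimes> inv x \<in> group_center G" if "x \<in> carrier G" "z \<in> group_center G" for x z
  proof -
    have z: "z \<in> carrier G" "x \<otimes> z = z \<otimes> x" using that by (auto simp: group_center_def)
    then have "x \<otimes> z \<otimes> inv x = z" using that(1) by (simp add: m_assoc)
    then show ?thesis using that(2) by simp
  qed
qed

lemma commutator_closed:
  "x \<in> carrier G \<Longrightarrow> y \<in> carrier G \<Longrightarrow> commutator G x y \<in> carrier G"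
  by (simp add: commutator_def)

lemma commutator_eq_one_iff:
  assumes "x \<in> carrier G" "y \<in> carrier G"
  shows "commutator G x y = \<one> \<longleftrightarrow> y \<in> centralizer G x"
proof -
  have "commutator G x y = inv (y \<otimes> x) \<otimes> (x \<otimes> y)"
    using assms by (simp add: commutator_def inv_mult_group m_assoc)
  then show ?thesis
    using assms inv_solve_left'[of \<one> "y \<otimes> x" "x \<otimes> y"] by (simp add: centralizer_def)
qed

lemma iter_comm_closed: "(\<And>i. i \<le> k \<Longrightarrow> x i \<in> carrier G) \<Longrightarrow> iter_comm G x k \<in> carrier G"
  by (induction k) (simp_all add: commutator_closed)

end

lemma (in group_hom) hom_commutator:
  "x \<in> carrier G \<Longrightarrow> y \<in> carrier G \<Longrightarrow> h (commutator G x y) = commutator H (h x) (h y)"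
  by (simp add: commutator_def)

lemma (in group_hom) hom_iter_comm:
  "(\<And>i. i \<le> k \<Longrightarrow> x i \<in> carrier G) \<Longrightarrow> h (iter_comm G x k) = iter_comm H (\<lambda>i. h (x i)) k"
  by (induction k) (simp_all add: hom_commutator G.iter_comm_closed)

lemma iter_comm_cong: "(\<And>i. i \<le> k \<Longrightarrow> x i = y i) \<Longrightarrow> iter_comm G x k = iter_comm G y k"
  by (induction k) auto

lemma iter_comm_upd: "k < i \<Longrightarrow> iter_comm G (x(i := y)) k = iter_comm G x k"
  by (rule iter_comm_cong) auto

context normal
begin

lemma commutator_mem_iff:
  assumes x: "x \<in> carrier G" and y: "y \<in> carrier G"
  shows "commutator G x y \<in> H \<longleftrightarrow> H #> y \<in> centralizer (G Mod H) (H #> x)"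
proof -
  interpret projection: group_hom G "G Mod H" "\<lambda>x. H #> x" by (rule group_hom_quotient)
  have "commutator G x y \<in> H \<longleftrightarrow> H #> commutator G x y = \<one>\<^bsub>G Mod H\<^esub>"
    using commutator_closed[OF x y] kernel_quotient[unfolded kernel_def] by blast
  also have "\<dots> \<longleftrightarrow> commutator (G Mod H) (H #> x) (H #> y) = \<one>\<^bsub>G Mod H\<^esub>"
    by (simp only: projection.hom_commutator[OF x y])
  also have "\<dots> \<longleftrightarrow> H #> y \<in> centralizer (G Mod H) (H #> x)"
    by (intro projection.H.commutator_eq_one_iff projection.hom_closed x y)
  finally show ?thesis .
qed

lemma subgroup_commutator_mem:
  assumes x: "x \<in> carrier G"
  shows "subgroup {y \<in> carrier G. commutator G x y \<in> H} G"
proof -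
  interpret projection: group_hom G "G Mod H" "\<lambda>x. H #> x" by (rule group_hom_quotient)
  have "{y \<in> carrier G. commutator G x y \<in> H} = {y \<in> carrier G. H #> y \<in> centralizer (G Mod H) (H #> x)}"
    by (intro Collect_cong conj_cong refl commutator_mem_iff[OF x])
  then show ?thesis
    using projection.subgroup_vimage[OF projection.H.subgroup_centralizer[OF projection.hom_closed[OF x]]]
    by (simp only:)
qed

lemma commutator_mult_notin:
  assumes x: "x \<in> carrier G" and g: "g \<in> carrier G" "commutator G x g \<notin> H"
    and y: "y \<in> carrier G" "commutator G x y \<in> H"
  shows "commutator G x (g \<otimes> y) \<notin> H"
proof
  let ?C = "{y \<in> carrier G. commutator G x y \<in> H}"
  have C: "subgroup ?C G" by (rule subgroup_commutator_mem[OF x])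
  assume "commutator G x (g \<otimes> y) \<in> H"
  then have "g \<otimes> y \<in> ?C" "y \<in> ?C" using g(1) y by simp_all
  then have "g \<otimes> y \<otimes> inv y \<in> ?C" by (rule subgroup.m_closed[OF C _ subgroup.m_inv_closed[OF C]])
  also have "g \<otimes> y \<otimes> inv y = g" using g(1) y(1) by (simp add: m_assoc)
  finally show False using g(2) by simp
qed

end

context group
begin

lemma normal_upper_central: "upper_central G i \<lhd> G"
proof (induction i)
  case 0 then show ?case by (simp add: one_is_normal)
next
  case (Suc i)
  interpret projection: group_hom G "G Mod upper_central G i" "\<lambda>x. upper_central G i #> x"
    by (rule normal.group_hom_quotient[OF Suc.IH])
  show ?case using projection.normal_vimage[OF projection.H.normal_group_center] by simp
qed

lemma mem_upper_central_Suc: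
  "x \<in> upper_central G (Suc i) \<longleftrightarrow> x \<in> carrier G \<and> (\<forall>y\<in>carrier G. commutator G x y \<in> upper_central G i)"
proof (cases "x \<in> carrier G")
  case True
  let ?Z = "upper_central G i"
  interpret normal ?Z G by (rule normal_upper_central)
  have "x \<in> upper_central G (Suc i) \<longleftrightarrow> (\<forall>y\<in>carrier G. ?Z #> y \<in> centralizer (G Mod ?Z) (?Z #> x))"
    using True by (auto simp: group_center_def centralizer_def carrier_FactGroup)
  then show ?thesis using True commutator_mem_iff by simp
qed auto

end

context compact_topological_group
begin

lemma continuous_map_commutator:
  assumes "continuous_map S T f" "continuous_map S T g"
  shows "continuous_map S T (\<lambda>x. commutator G (f x) (g x))"
  unfolding commutator_def using assms by (intro continuous_map_mult continuous_map_inv)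

lemma closedin_upper_central: "closedin T (upper_central G i)"
proof (induction i)
  case 0 show ?case using Hausdorff_space by (simp add: closedin_Hausdorff_sing_eq)
next
  case (Suc i)
  have "closedin T (\<Inter>y\<in>carrier G. {x \<in> topspace T. commutator G x y \<in> upper_central G i})"
  proof (intro closedin_INT closedin_continuous_map_preimage[OF _ Suc.IH] continuous_map_commutator)
    show "carrier G \<noteq> {}" by auto
  qed auto
  also have "(\<Inter>y\<in>carrier G. {x \<in> topspace T. commutator G x y \<in> upper_central G i}) = upper_central G (Suc i)"
    using mem_upper_central_Suc by (auto simp del: upper_central.simps)
  finally show ?case .
qed

lemma closed_normal_subgroup_upper_central: "closed_normal_subgroup G T (upper_central G i)"
  using normal_upper_central closedin_upper_central compact_topological_group_axioms
  by (simp add: closed_normal_subgroup_def closed_normal_subgroup_axioms_def)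

end

section \<open>Commutativity degrees\<close>

lemma emeasure_le_twice_Diff:
  assumes A: "A \<in> sets M" and F: "F \<in> sets M" and moved: "emeasure M (A \<inter> F) \<le> emeasure M (A - F)"
  shows "emeasure M A \<le> 2 * emeasure M (A - F)"
proof -
  have "emeasure M A = emeasure M (A \<inter> F) + emeasure M (A - F)"
    using A F by (subst plus_emeasure) (auto simp: Int_Diff_Un)
  also have "\<dots> \<le> 2 * emeasure M (A - F)" using moved by (simp add: mult_2 add_right_mono)
  finally show ?thesis .
qed

lemma emeasure_Un_le_twice_Diff:
  assumes sets: "A \<in> sets M" "B \<in> sets M" "F \<in> sets M" and disjoint: "A \<inter> B = {}"
    and A: "emeasure M A \<le> 2 * emeasure M (A - F)" and B: "emeasure M B \<le> 2 * emeasure M (B - F)"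
  shows "emeasure M (A \<union> B) \<le> 2 * emeasure M (A \<union> B - F)"
proof -
  have "emeasure M (A \<union> B) = emeasure M A + emeasure M B"
    using sets disjoint by (simp add: plus_emeasure)
  also have "\<dots> \<le> 2 * emeasure M (A - F) + 2 * emeasure M (B - F)" by (intro add_mono A B)
  also have "\<dots> = 2 * (emeasure M (A - F) + emeasure M (B - F))" by (simp add: distrib_left)
  also have "emeasure M (A - F) + emeasure M (B - F) = emeasure M ((A - F) \<union> (B - F))"
    using sets disjoint by (intro plus_emeasure) auto
  finally show ?thesis by (simp add: Un_Diff)
qed

context compact_topological_group
begin

context
  fixes \<mu> J h U F
  assumes \<mu>: "is_haar G T \<mu>" and F: "F \<in> sets (borel_of T)"
    and h: "\<And>j. j \<in> J \<Longrightarrow> h j \<in> carrier G" and U: "\<And>j. j \<in> J \<Longrightarrow> openin T (U j)"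
    and invariant: "\<And>i j x. i \<in> J \<Longrightarrow> j \<in> J \<Longrightarrow> x \<in> carrier G \<Longrightarrow> h i \<otimes> x \<in> U j \<longleftrightarrow> x \<in> U j"
    and moves: "\<And>j x. j \<in> J \<Longrightarrow> x \<in> U j \<Longrightarrow> x \<in> F \<Longrightarrow> h j \<otimes> x \<notin> F"
begin

lemma haar_finite_Union_le_twice_Diff:
  assumes "finite D" "D \<subseteq> J"
  shows "emeasure \<mu> (\<Union>j\<in>D. U j) \<le> 2 * emeasure \<mu> ((\<Union>j\<in>D. U j) - F)"
  using assms
proof (induction D)
  case empty show ?case by simp
next
  case (insert i D)
  let ?V = "\<Union>j\<in>D. U j"
  let ?A = "U i - ?V"
  have i: "i \<in> J" and D: "D \<subseteq> J" using insert.prems by auto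
  have U_sets: "U j \<in> sets \<mu>" if "j \<in> J" for j
    using U[OF that] by (simp add: haar_sets[OF \<mu>] openin_in_sets_borel_of)
  then have "?V \<in> sets \<mu>" using D insert.hyps(1) by (intro sets.finite_UN) auto
  then have sets: "F \<in> sets \<mu>" "?V \<in> sets \<mu>" "?A \<in> sets \<mu>"
    using F U_sets[OF i] by (simp_all add: haar_sets[OF \<mu>] sets.Diff)
  have "?A \<inter> F \<in> sets (borel_of T)" using sets by (auto simp: haar_sets[OF \<mu>])
  then have "emeasure \<mu> (?A \<inter> F) = emeasure \<mu> (h i <# (?A \<inter> F))"
    by (rule haar_l_coset[OF \<mu> h[OF i], symmetric])
  also have "\<dots> \<le> emeasure \<mu> (?A - F)"
  proof (rule emeasure_mono)
    show "h i <# (?A \<inter> F) \<subseteq> ?A - F"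
      using openin_subset_carrier[OF U[OF i]] D invariant[OF i] moves[OF i] i
      by (auto simp: l_coset_eq_image subset_iff)
  qed (use sets in auto)
  finally have "emeasure \<mu> ?A \<le> 2 * emeasure \<mu> (?A - F)"
    by (rule emeasure_le_twice_Diff[OF sets(3,1)])
  then have "emeasure \<mu> (?A \<union> ?V) \<le> 2 * emeasure \<mu> (?A \<union> ?V - F)"
    using insert.IH[OF D] sets by (intro emeasure_Un_le_twice_Diff) auto
  then show ?case by simp
qed

lemma haar_Union_le_twice_Diff:
  "emeasure \<mu> (\<Union>j\<in>J. U j) \<le> 2 * emeasure \<mu> ((\<Union>j\<in>J. U j) - F)"
proof (rule regular_borel_measure_Union_le[OF haar_regular[OF \<mu>] U])
  fix D assume D: "finite D" "D \<subseteq> J"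
  have "(\<Union>j\<in>J. U j) \<in> sets \<mu>"
    unfolding haar_sets[OF \<mu>] using U by (intro openin_in_sets_borel_of openin_Union) auto
  then have "emeasure \<mu> ((\<Union>j\<in>D. U j) - F) \<le> emeasure \<mu> ((\<Union>j\<in>J. U j) - F)"
    using D(2) F by (intro emeasure_mono) (auto simp: haar_sets[OF \<mu>])
  then show "emeasure \<mu> (\<Union>j\<in>D. U j) \<le> 2 * emeasure \<mu> ((\<Union>j\<in>J. U j) - F)"
    by (intro order_trans[OF haar_finite_Union_le_twice_Diff[OF D]] mult_left_mono) auto
qed

end

end

abbreviation power_group :: "('a, 'b) monoid_scheme \<Rightarrow> nat \<Rightarrow> (nat \<Rightarrow> 'a) monoid" where
  "power_group G m \<equiv> product_group {..m} (\<lambda>_. G)"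

abbreviation power_topology :: "'a topology \<Rightarrow> nat \<Rightarrow> (nat \<Rightarrow> 'a) topology" where
  "power_topology T m \<equiv> product_topology (\<lambda>_. T) {..m}"

definition iter_comm_event :: "('a, 'b) monoid_scheme \<Rightarrow> nat \<Rightarrow> nat \<Rightarrow> 'a set \<Rightarrow> (nat \<Rightarrow> 'a) set" where
  "iter_comm_event G m k N = {x \<in> carrier (power_group G m). iter_comm G x k \<in> N}"

lemma comm_degree_eq_measure_event:
  "comm_degree m G T =
     measure (haar_measure (power_group G m) (power_topology T m)) (iter_comm_event G m m {\<one>\<^bsub>G\<^esub>})"
  by (simp add: comm_degree_def iter_comm_event_def)

lemma (in group) power_group_iter_comm_closed:
  "x \<in> carrier (power_group G m) \<Longrightarrow> k \<le> m \<Longrightarrow> iter_comm G x k \<in> carrier G"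
  by (intro iter_comm_closed) auto

definition coordinate_element :: "('a, 'b) monoid_scheme \<Rightarrow> nat \<Rightarrow> nat \<Rightarrow> 'a \<Rightarrow> nat \<Rightarrow> 'a" where
  "coordinate_element G m i g = (\<lambda>j\<in>{..m}. if j = i then g else \<one>\<^bsub>G\<^esub>)"

definition noncentralized_event ::
    "('a, 'b) monoid_scheme \<Rightarrow> nat \<Rightarrow> nat \<Rightarrow> 'a set \<Rightarrow> 'a \<Rightarrow> (nat \<Rightarrow> 'a) set" where
  "noncentralized_event G m k N g = {x \<in> carrier (power_group G m). commutator G (iter_comm G x k) g \<notin> N}"

definition power_map :: "('a \<Rightarrow> 'c) \<Rightarrow> nat \<Rightarrow> (nat \<Rightarrow> 'a) \<Rightarrow> nat \<Rightarrow> 'c" where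
  "power_map \<phi> k x = (\<lambda>i\<in>{..k}. \<phi> (x i))"

lemma power_map_hom:
  assumes "\<phi> \<in> hom G H" and "k \<le> m"
  shows "power_map \<phi> k \<in> hom (power_group G m) (power_group H k)"
  using assms by (auto simp: hom_def power_map_def PiE_iff fun_eq_iff split: if_splits)

lemma power_map_image:
  assumes surj: "\<phi> ` carrier G = carrier H" and k: "k \<le> m"
  shows "power_map \<phi> k ` carrier (power_group G m) = carrier (power_group H k)"
proof (intro equalityI subsetI)
  fix y assume y: "y \<in> carrier (power_group H k)"
  then have "\<exists>a. a \<in> carrier G \<and> \<phi> a = y i" if "i \<le> k" for i
    using surj PiE_mem[of y "{..k}" _ i] that by (metis atMost_iff carrier_product_group imageE)
  then obtain a where a: "\<And>i. i \<le> k \<Longrightarrow> a i \<in> carrier G" "\<And>i. i \<le> k \<Longrightarrow> \<phi> (a i) = y i" by metis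
  let ?x = "\<lambda>i\<in>{..m}. a (min i k)"
  have "power_map \<phi> k ?x = y"
    using a(2) k y by (auto simp: power_map_def fun_eq_iff PiE_iff extensional_def)
  moreover have "?x \<in> carrier (power_group G m)" using a(1) by simp
  ultimately show "y \<in> power_map \<phi> k ` carrier (power_group G m)" by blast
next
  have "\<phi> a \<in> carrier H" if "a \<in> carrier G" for a using that surj by blast
  then show "y \<in> carrier (power_group H k)" if "y \<in> power_map \<phi> k ` carrier (power_group G m)" for y
    using that k by (auto simp: power_map_def PiE_iff split: if_splits)
qed

lemma (in group_hom) power_map_vimage_iter_comm_event:
  assumes k: "k \<le> m"
  shows "power_map h k -` iter_comm_event H k k {\<one>\<^bsub>H\<^esub>} \<inter> carrier (power_group G m) =
    iter_comm_event G m k (kernel G H h)"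
proof -
  have "power_map h k x \<in> iter_comm_event H k k {\<one>\<^bsub>H\<^esub>} \<longleftrightarrow> iter_comm G x k \<in> kernel G H h"
    if x: "x \<in> carrier (power_group G m)" for x
  proof -
    have "iter_comm H (power_map h k x) k = iter_comm H (\<lambda>i. h (x i)) k"
      by (rule iter_comm_cong) (simp add: power_map_def)
    also have "\<dots> = h (iter_comm G x k)"
      using x k by (intro hom_iter_comm[symmetric]) auto
    moreover have "power_map h k x \<in> carrier (power_group H k)"
      using power_map_hom[OF homh k] x unfolding hom_def by blast
    ultimately show ?thesis
      using G.power_group_iter_comm_closed[OF x k] unfolding iter_comm_event_def kernel_def by simp
  qed
  then show ?thesis unfolding iter_comm_event_def[of G] by blast
qed

lemma continuous_map_power_map:
  assumes "continuous_map T S \<phi>" and "k \<le> m"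
  shows "continuous_map (power_topology T m) (power_topology S k) (power_map \<phi> k)"
  unfolding continuous_map_componentwise
proof (intro conjI ballI)
  show "power_map \<phi> k ` topspace (power_topology T m) \<subseteq> extensional {..k}"
    by (auto simp: power_map_def)
  fix i assume i: "i \<in> {..k}"
  then have "continuous_map (power_topology T m) T (\<lambda>x. x i)"
    using assms(2) by (intro continuous_map_product_projection) auto
  from continuous_map_compose[OF this assms(1)] i
  show "continuous_map (power_topology T m) S (\<lambda>x. power_map \<phi> k x i)"
    by (simp add: comp_def power_map_def)
qed

context compact_topological_group
begin

lemma compact_topological_group_power:
  "compact_topological_group (power_group G m) (power_topology T m)"
  by unfold_locales (rule compact_group_product[OF compact_group])

lemma coordinate_element_closed:
  "g \<in> carrier G \<Longrightarrow> coordinate_element G m i g \<in> carrier (power_group G m)"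
  by (auto simp: coordinate_element_def)

lemma coordinate_element_mult:
  assumes "g \<in> carrier G" "x \<in> carrier (power_group G m)" "i \<le> m"
  shows "coordinate_element G m i g \<otimes>\<^bsub>power_group G m\<^esub> x = x(i := g \<otimes> x i)"
  using assms by (auto simp: coordinate_element_def fun_eq_iff PiE_iff extensional_def)

lemma continuous_map_iter_comm:
  "k \<le> m \<Longrightarrow> continuous_map (power_topology T m) T (\<lambda>x. iter_comm G x k)"
  by (induction k) (auto intro!: continuous_map_commutator continuous_map_product_projection)

lemma closedin_iter_comm_event:
  assumes "k \<le> m" "closedin T N"
  shows "closedin (power_topology T m) (iter_comm_event G m k N)"
  using closedin_continuous_map_preimage[OF continuous_map_iter_comm[OF assms(1)] assms(2)]
  by (simp add: iter_comm_event_def)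

lemma iter_comm_event_Compl_eq_Union:
  assumes "k \<le> m"
  shows "carrier (power_group G m) - iter_comm_event G m k (upper_central G (Suc j)) =
    (\<Union>g\<in>carrier G. noncentralized_event G m k (upper_central G j) g)"
proof (intro equalityI subsetI)
  fix x assume "x \<in> carrier (power_group G m) - iter_comm_event G m k (upper_central G (Suc j))"
  then have x: "x \<in> carrier (power_group G m)" "iter_comm G x k \<notin> upper_central G (Suc j)"
    unfolding iter_comm_event_def by blast+
  then obtain g where "g \<in> carrier G" "commutator G (iter_comm G x k) g \<notin> upper_central G j"
    using power_group_iter_comm_closed[OF x(1) assms] unfolding mem_upper_central_Suc by blast
  then show "x \<in> (\<Union>g\<in>carrier G. noncentralized_event G m k (upper_central G j) g)"
    using x(1) unfolding noncentralized_event_def by blast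
next
  fix x assume "x \<in> (\<Union>g\<in>carrier G. noncentralized_event G m k (upper_central G j) g)"
  then show "x \<in> carrier (power_group G m) - iter_comm_event G m k (upper_central G (Suc j))"
    unfolding noncentralized_event_def iter_comm_event_def mem_upper_central_Suc by blast
qed

lemma openin_noncentralized_event:
  assumes k: "k \<le> m" and N: "closedin T N" and g: "g \<in> carrier G"
  shows "openin (power_topology T m) (noncentralized_event G m k N g)"
proof -
  let ?C = "{x \<in> topspace (power_topology T m). commutator G (iter_comm G x k) g \<in> N}"
  have "continuous_map (power_topology T m) T (\<lambda>x. commutator G (iter_comm G x k) g)"
    using g k by (intro continuous_map_commutator continuous_map_iter_comm) auto
  then have "closedin (power_topology T m) ?C"
    using N by (rule closedin_continuous_map_preimage)
  then have "openin (power_topology T m) (topspace (power_topology T m) - ?C)"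
    by (rule openin_diff[OF openin_topspace])
  also have "topspace (power_topology T m) - ?C = noncentralized_event G m k N g"
    by (auto simp: noncentralized_event_def)
  finally show ?thesis .
qed

lemma coordinate_element_noncentralized_event_iff:
  assumes g: "g \<in> carrier G" and x: "x \<in> carrier (power_group G m)" and k: "Suc k \<le> m"
  shows "coordinate_element G m (Suc k) g \<otimes>\<^bsub>power_group G m\<^esub> x \<in> noncentralized_event G m k N g'
    \<longleftrightarrow> x \<in> noncentralized_event G m k N g'"
proof -
  interpret P: compact_topological_group "power_group G m" "power_topology T m"
    by (rule compact_topological_group_power)
  have "coordinate_element G m (Suc k) g \<otimes>\<^bsub>power_group G m\<^esub> x \<in> carrier (power_group G m)"
    by (intro P.m_closed coordinate_element_closed g x)
  then show ?thesis
    using x unfolding noncentralized_event_def coordinate_element_mult[OF g x k]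
    by (simp add: iter_comm_upd del: carrier_product_group)
qed

lemma coordinate_element_moves_iter_comm_event:
  assumes N: "N \<lhd> G" and g: "g \<in> carrier G" and k: "Suc k \<le> m"
    and x: "x \<in> noncentralized_event G m k N g" "x \<in> iter_comm_event G m (Suc k) N"
  shows "coordinate_element G m (Suc k) g \<otimes>\<^bsub>power_group G m\<^esub> x \<notin> iter_comm_event G m (Suc k) N"
proof -
  interpret N: normal N G by (rule N)
  have xP: "x \<in> carrier (power_group G m)" using x(2) by (simp add: iter_comm_event_def)
  have "iter_comm G x k \<in> carrier G" "x (Suc k) \<in> carrier G"
    using power_group_iter_comm_closed[OF xP, of k] PiE_mem[of x "{..m}" _ "Suc k"] xP k by auto
  then have "commutator G (iter_comm G x k) (g \<otimes> x (Suc k)) \<notin> N"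
    using x g by (intro N.commutator_mult_notin)
      (simp_all add: noncentralized_event_def iter_comm_event_def)
  then show ?thesis
    unfolding coordinate_element_mult[OF g xP k] by (simp add: iter_comm_event_def iter_comm_upd)
qed

lemma iter_comm_event_Compl_halving:
  assumes \<mu>: "is_haar (power_group G m) (power_topology T m) \<mu>" and k: "Suc k \<le> m"
  shows "emeasure \<mu> (carrier (power_group G m) - iter_comm_event G m k (upper_central G (Suc j)))
    \<le> 2 * emeasure \<mu> (carrier (power_group G m) - iter_comm_event G m (Suc k) (upper_central G j))"
proof -
  let ?Z = "upper_central G j" and ?P = "carrier (power_group G m)"
  let ?U = "noncentralized_event G m k ?Z" and ?F = "iter_comm_event G m (Suc k) ?Z"
  interpret P: compact_topological_group "power_group G m" "power_topology T m"
    by (rule compact_topological_group_power)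
  have F: "closedin (power_topology T m) ?F"
    by (rule closedin_iter_comm_event[OF k closedin_upper_central])
  have "emeasure \<mu> (\<Union>g\<in>carrier G. ?U g) \<le> 2 * emeasure \<mu> ((\<Union>g\<in>carrier G. ?U g) - ?F)"
    using k F
    by (intro P.haar_Union_le_twice_Diff[OF \<mu>, where h = "coordinate_element G m (Suc k)"]
        closedin_in_sets_borel_of coordinate_element_closed openin_noncentralized_event
        closedin_upper_central coordinate_element_noncentralized_event_iff
        coordinate_element_moves_iter_comm_event normal_upper_central) simp_all
  also have "\<dots> \<le> 2 * emeasure \<mu> (?P - ?F)"
  proof (intro mult_left_mono emeasure_mono)
    show "(\<Union>g\<in>carrier G. ?U g) - ?F \<subseteq> ?P - ?F" by (auto simp: noncentralized_event_def)
    show "?P - ?F \<in> sets \<mu>"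
      unfolding P.haar_sets[OF \<mu>]
      by (intro sets.Diff closedin_in_sets_borel_of[OF F] openin_in_sets_borel_of P.openin_carrier)
  qed simp
  finally show ?thesis
    unfolding iter_comm_event_Compl_eq_Union[OF Suc_leD[OF k]] .
qed

lemma one_minus_iter_comm_event_le:
  assumes \<mu>: "is_haar (power_group G m) (power_topology T m) \<mu>" and k: "Suc k \<le> m"
  shows "1 - measure \<mu> (iter_comm_event G m k (upper_central G (Suc j)))
    \<le> 2 * (1 - measure \<mu> (iter_comm_event G m (Suc k) (upper_central G j)))"
proof -
  interpret P: compact_topological_group "power_group G m" "power_topology T m"
    by (rule compact_topological_group_power)
  interpret finite_measure \<mu>
    by (rule finite_measureI, unfold P.haar_space[OF \<mu>] P.haar_carrier[OF \<mu>]) simp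
  have total: "measure \<mu> (carrier (power_group G m)) = 1"
    by (simp only: measure_def P.haar_carrier[OF \<mu>] enn2real_1)
  let ?E = "\<lambda>i l. iter_comm_event G m i (upper_central G l)"
  have compl: "measure \<mu> (carrier (power_group G m) - ?E i l) = 1 - measure \<mu> (?E i l)" if "i \<le> m" for i l
    using finite_measure_compl[of "?E i l"]
      closedin_in_sets_borel_of[OF closedin_iter_comm_event[OF that closedin_upper_central]]
    by (simp only: P.haar_space[OF \<mu>] P.haar_sets[OF \<mu>] total)
  have "ennreal (measure \<mu> (carrier (power_group G m) - ?E k (Suc j)))
      \<le> ennreal (2 * measure \<mu> (carrier (power_group G m) - ?E (Suc k) j))"
    using iter_comm_event_Compl_halving[OF \<mu> k, of j]
    by (simp only: emeasure_eq_measure ennreal_mult' ennreal_numeral measure_nonneg)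
  then have "measure \<mu> (carrier (power_group G m) - ?E k (Suc j))
      \<le> 2 * measure \<mu> (carrier (power_group G m) - ?E (Suc k) j)"
    by (subst (asm) ennreal_le_iff) simp_all
  then show ?thesis unfolding compl[OF k] compl[OF Suc_leD[OF k]] .
qed

lemma one_minus_iter_comm_event_le_power:
  assumes \<mu>: "is_haar (power_group G m) (power_topology T m) \<mu>" and "k + i \<le> m"
  shows "1 - measure \<mu> (iter_comm_event G m k (upper_central G (j + i)))
    \<le> 2 ^ i * (1 - measure \<mu> (iter_comm_event G m (k + i) (upper_central G j)))"
  using assms(2)
proof (induction i arbitrary: j)
  case 0 show ?case by simp
next
  case (Suc i)
  have "1 - measure \<mu> (iter_comm_event G m k (upper_central G (j + Suc i)))
      \<le> 2 ^ i * (1 - measure \<mu> (iter_comm_event G m (k + i) (upper_central G (Suc j))))"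
    using Suc.IH[of "Suc j"] Suc.prems by simp
  also have "\<dots> \<le> 2 ^ i * (2 * (1 - measure \<mu> (iter_comm_event G m (Suc (k + i)) (upper_central G j))))"
    using Suc.prems by (intro mult_left_mono one_minus_iter_comm_event_le[OF \<mu>]) auto
  finally show ?case by (simp only: power_Suc mult_ac add_Suc_right)
qed

end

lemma comm_degree_image:
  assumes G: "compact_group G T" and H: "compact_group H S"
    and hom: "\<phi> \<in> hom G H" and surj: "\<phi> ` carrier G = carrier H" and cont: "continuous_map T S \<phi>"
    and \<mu>: "is_haar (power_group G m) (power_topology T m) \<mu>" and k: "k \<le> m"
  shows "comm_degree k H S = measure \<mu> (iter_comm_event G m k (kernel G H \<phi>))"
proof -
  interpret G: compact_topological_group G T using G by unfold_locales
  interpret H: compact_topological_group H S using H by unfold_locales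
  interpret \<phi>: group_hom G H \<phi> using hom by unfold_locales
  interpret PG: compact_topological_group "power_group G m" "power_topology T m"
    by (rule G.compact_topological_group_power)
  interpret PH: compact_topological_group "power_group H k" "power_topology S k"
    by (rule H.compact_topological_group_power)
  let ?\<phi> = "power_map \<phi> k" and ?E = "iter_comm_event H k k {\<one>\<^bsub>H\<^esub>}"
  have cont_power: "continuous_map (power_topology T m) (power_topology S k) ?\<phi>"
    by (rule continuous_map_power_map[OF cont k])
  have image: "?\<phi> ` carrier (power_group G m) = carrier (power_group H k)"
    by (rule power_map_image[OF surj k])
  have haar_eq: "haar_measure (power_group H k) (power_topology S k) =
      distr \<mu> (borel_of (power_topology S k)) ?\<phi>"
    by (intro PH.haar_measure_eqI is_haar_distr[OF PG.compact_group PH.compact_group _ image cont_power \<mu>]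
        power_map_hom hom k)
  have "closedin S {\<one>\<^bsub>H\<^esub>}"
    using H.Hausdorff_space by (simp add: closedin_Hausdorff_sing_eq)
  then have E: "?E \<in> sets (borel_of (power_topology S k))"
    by (intro closedin_in_sets_borel_of H.closedin_iter_comm_event order_refl)
  have "comm_degree k H S = measure \<mu> (?\<phi> -` ?E \<inter> carrier (power_group G m))"
    unfolding comm_degree_eq_measure_event haar_eq measure_def
    using emeasure_distr_regular_borel_measure[OF PG.haar_regular[OF \<mu>] cont_power E] by simp
  then show ?thesis by (simp only: \<phi>.power_map_vimage_iter_comm_event[OF k])
qed

lemma (in closed_normal_subgroup) comm_degree_quotient:
  assumes "is_haar (power_group G m) (power_topology T m) \<mu>" and "k \<le> m"
  shows "comm_degree k (G Mod N) quotient_topology = measure \<mu> (iter_comm_event G m k N)"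
  using comm_degree_image[OF compact_group compact_group_quotient r_coset_hom_Mod _ _ assms]
    quotient_map_projection
  by (simp add: kernel_quotient carrier_FactGroup quotient_imp_continuous_map)

theorem theorem3p4:
  fixes G :: "('a, 'b) monoid_scheme" and T :: "'a topology" and n :: nat
  assumes "compact_group G T" and "n \<ge> 1"
  shows "comm_degree (Suc n) G T
    \<le> (2 ^ n - 1 + comm_degree 1 (G Mod upper_central G n) (quotient_top G T (upper_central G n))) / 2 ^ n"
proof -
  interpret compact_topological_group G T using assms(1) by unfold_locales
  interpret Z: closed_normal_subgroup G T "upper_central G n" by (rule closed_normal_subgroup_upper_central)
  interpret power: compact_topological_group "power_group G (Suc n)" "power_topology T (Suc n)"
    by (rule compact_topological_group_power)
  define \<mu> where "\<mu> = haar_measure (power_group G (Suc n)) (power_topology T (Suc n))"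
  have \<mu>: "is_haar (power_group G (Suc n)) (power_topology T (Suc n)) \<mu>"
    unfolding \<mu>_def by (rule power.is_haar_haar_measure)
  have "1 - measure \<mu> (iter_comm_event G (Suc n) 1 (upper_central G n))
      \<le> 2 ^ n * (1 - measure \<mu> (iter_comm_event G (Suc n) (Suc n) {\<one>\<^bsub>G\<^esub>}))"
    using one_minus_iter_comm_event_le_power[OF \<mu>, of 1 n 0] by simp
  then have "1 - comm_degree 1 (G Mod upper_central G n) (quotient_top G T (upper_central G n))
      \<le> 2 ^ n * (1 - comm_degree (Suc n) G T)"
    using Z.comm_degree_quotient[OF \<mu>, of 1] by (simp add: comm_degree_eq_measure_event \<mu>_def)
  then show ?thesis by (simp add: field_simps)
qed

end
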